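(* Let $a,b>0$ and $f\in L^2(\mathbb R)$ be such that the Gabor system $\{E_{mb}\mathcal T_{na}f\}_{m,n\in\mathbb Z}$ is a frame for $L^2(\mathbb R)$. If the adjoint system $\left\{\frac{1}{\sqrt{ab}}E_{\frac ma}\mathcal T_{\frac nb}f\right\}_{m,n\in\mathbb Z}$ is a weak R-dual of $\{E_{mb}\mathcal T_{na}f\}_{m,n\in\mathbb Z}$ (with respect to some Parseval frames for $L^2(\mathbb R)$), then the adjoint system is also an R-dual of $\{E_{mb}\mathcal T_{na}f\}_{m,n\in\mathbb Z}$ (with respect to some orthonormal bases of $L^2(\mathbb R)$).
   Context: For $x\in\mathbb R$, $(E_xg)(t)=e^{2\pi ixt}g(t)$ and $(\mathcal T_xg)(t)=g(t-x)$ on $L^2(\mathbb R)$. All sequences here are indexed by $I=\mathbb Z\times\mathbb Z$. Inner products are linear in the first variable. A sequence $\{f_i\}_{i\in I}$ in a Hilbert space $H$ is a frame for $H$ if there are $0<A\le B<\infty$ with $A\|x\|^2\le\sum_{i}|\langle x,f_i\rangle|^2\le B\|x\|^2$ for all $x\in H$; it is a Parseval frame if one can take $A=B=1$. Weak R-dual: let $u=\{u_i\}_{i\in I},v=\{v_i\}_{i\in I}$ be Parseval frames for $H$ and $f=\{f_i\}_{i\in I}$ a sequence in $H$ such that $\sum_{i\in I}|\langle f_i,u_j\rangle|^2<\infty$ for all $j\in I$ and $\sum_{k\in I}\langle v_k,v_i\rangle\langle f_k,u_j\rangle=\langle f_i,u_j\rangle$ for all $i,j\in I$. Then $w=\{w_j\}_{j\in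 I}$ given by $w_j=\sum_{i\in I}\langle f_i,u_j\rangle v_i$ is called the weak R-dual of $f$ with respect to $u$ and $v$. R-dual: if $u,v$ are orthonormal bases of $H$ and $\sum_{i}|\langle f_i,u_j\rangle|^2<\infty$ for all $j$, then $w_j=\sum_{i\in I}\langle f_i,u_j\rangle v_i$, $j\in I$, is the R-dual of $f$ with respect to $u$ and $v$. *)

theory Defs
  imports "HOL-Analysis.Analysis"
begin

text \<open>
  Elements of \<open>L\<^sup>2(\<real>)\<close> are represented by Borel measurable, square integrable functions
  \<open>\<real> \<rightarrow> \<complex>\<close>. Two functions represent the same element iff they agree almost everywhere, i.e. iff
  the norm of their difference is zero; every notion below depends on its arguments only through
  the elements they represent.
\<close>

definition L2 :: "(real \<Rightarrow> complex) set" where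
  "L2 = {g \<in> borel_measurable lborel. integrable lborel (\<lambda>t. (cmod (g t))\<^sup>2)}"

definition L2_inner :: "(real \<Rightarrow> complex) \<Rightarrow> (real \<Rightarrow> complex) \<Rightarrow> complex" where
  "L2_inner g h = (\<integral>t. g t * cnj (h t) \<partial>lborel)"

definition L2_norm :: "(real \<Rightarrow> complex) \<Rightarrow> real" where
  "L2_norm g = sqrt (\<integral>t. (cmod (g t))\<^sup>2 \<partial>lborel)"

text \<open>Unconditional convergence of \<open>\<Sum>i. g i\<close> to \<open>s\<close> in the norm of \<open>L\<^sup>2(\<real>)\<close>.
  It is only used with all \<open>g i\<close> and \<open>s\<close> in \<^const>\<open>L2\<close>: outside, the integral in
  \<^const>\<open>L2_norm\<close> may take the junk value \<open>0\<close>.\<close>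

definition L2_has_sum :: "('i \<Rightarrow> real \<Rightarrow> complex) \<Rightarrow> (real \<Rightarrow> complex) \<Rightarrow> bool" where
  "L2_has_sum g s \<longleftrightarrow>
     ((\<lambda>F. L2_norm (\<lambda>t. s t - (\<Sum>i\<in>F. g i t))) \<longlongrightarrow> 0) (finite_subsets_at_top UNIV)"

definition modulation :: "real \<Rightarrow> (real \<Rightarrow> complex) \<Rightarrow> real \<Rightarrow> complex" where
  "modulation x g = (\<lambda>t. exp (2 * of_real pi * \<i> * of_real x * of_real t) * g t)"

definition translation :: "real \<Rightarrow> (real \<Rightarrow> complex) \<Rightarrow> real \<Rightarrow> complex" where
  "translation x g = (\<lambda>t. g (t - x))"

definition gabor_system :: "real \<Rightarrow> real \<Rightarrow> (real \<Rightarrow> complex) \<Rightarrow> int \<times> int \<Rightarrow> real \<Rightarrow> complex" where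
  "gabor_system a b f =
     (\<lambda>(m, n). modulation (of_int m * b) (translation (of_int n * a) f))"

definition adjoint_system :: "real \<Rightarrow> real \<Rightarrow> (real \<Rightarrow> complex) \<Rightarrow> int \<times> int \<Rightarrow> real \<Rightarrow> complex" where
  "adjoint_system a b f =
     (\<lambda>(m, n) t. of_real (1 / sqrt (a * b)) *
        modulation (of_int m / a) (translation (of_int n / b) f) t)"

definition frame_with_bounds :: "real \<Rightarrow> real \<Rightarrow> ('i \<Rightarrow> real \<Rightarrow> complex) \<Rightarrow> bool" where
  "frame_with_bounds A B g \<longleftrightarrow> range g \<subseteq> L2 \<and>
     (\<forall>x\<in>L2. (\<lambda>i. (cmod (L2_inner x (g i)))\<^sup>2) summable_on UNIV \<and>
        A * (L2_norm x)\<^sup>2 \<le> (\<Sum>\<^sub>\<infinity>i. (cmod (L2_inner x (g i)))\<^sup>2) \<and>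
        (\<Sum>\<^sub>\<infinity>i. (cmod (L2_inner x (g i)))\<^sup>2) \<le> B * (L2_norm x)\<^sup>2)"

definition frame :: "('i \<Rightarrow> real \<Rightarrow> complex) \<Rightarrow> bool" where
  "frame g \<longleftrightarrow> (\<exists>A B. 0 < A \<and> A \<le> B \<and> frame_with_bounds A B g)"

definition parseval_frame :: "('i \<Rightarrow> real \<Rightarrow> complex) \<Rightarrow> bool" where
  "parseval_frame g \<longleftrightarrow> frame_with_bounds 1 1 g"

text \<open>An orthonormal basis is an orthonormal family whose linear span is dense.\<close>

definition orthonormal_basis :: "('i \<Rightarrow> real \<Rightarrow> complex) \<Rightarrow> bool" where
  "orthonormal_basis e \<longleftrightarrow> range e \<subseteq> L2 \<and>
     (\<forall>i j. L2_inner (e i) (e j) = (if i = j then 1 else 0)) \<and>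
     (\<forall>x\<in>L2. \<forall>\<epsilon>>0. \<exists>F c. finite F \<and> L2_norm (\<lambda>t. x t - (\<Sum>i\<in>F. c i * e i t)) < \<epsilon>)"

definition is_weak_R_dual ::
  "('i \<Rightarrow> real \<Rightarrow> complex) \<Rightarrow> ('i \<Rightarrow> real \<Rightarrow> complex) \<Rightarrow>
   ('i \<Rightarrow> real \<Rightarrow> complex) \<Rightarrow> ('i \<Rightarrow> real \<Rightarrow> complex) \<Rightarrow> bool" where
  "is_weak_R_dual w f u v \<longleftrightarrow>
     parseval_frame u \<and> parseval_frame v \<and> range f \<subseteq> L2 \<and> range w \<subseteq> L2 \<and>
     (\<forall>j. (\<lambda>i. (cmod (L2_inner (f i) (u j)))\<^sup>2) summable_on UNIV) \<and>
     (\<forall>i j. ((\<lambda>k. L2_inner (v k) (v i) * L2_inner (f k) (u j))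
               has_sum L2_inner (f i) (u j)) UNIV) \<and>
     (\<forall>j. L2_has_sum (\<lambda>i t. L2_inner (f i) (u j) * v i t) (w j))"

definition is_R_dual ::
  "('i \<Rightarrow> real \<Rightarrow> complex) \<Rightarrow> ('i \<Rightarrow> real \<Rightarrow> complex) \<Rightarrow>
   ('i \<Rightarrow> real \<Rightarrow> complex) \<Rightarrow> ('i \<Rightarrow> real \<Rightarrow> complex) \<Rightarrow> bool" where
  "is_R_dual w f u v \<longleftrightarrow>
     orthonormal_basis u \<and> orthonormal_basis v \<and> range f \<subseteq> L2 \<and> range w \<subseteq> L2 \<and>
     (\<forall>j. (\<lambda>i. (cmod (L2_inner (f i) (u j)))\<^sup>2) summable_on UNIV) \<and>
     (\<forall>j. L2_has_sum (\<lambda>i t. L2_inner (f i) (u j) * v i t) (w j))"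

end

theory Submission
  imports Defs
begin

text \<open>
  Write \<open>g\<^sub>i\<close> for the Gabor system, with frame bounds \<open>A \<le> B\<close>, and \<open>w\<^sub>j\<close> for its adjoint system. The weak
  R-dual conditions say \<open>\<langle>w\<^sub>j, v\<^sub>i\<rangle> = \<langle>g\<^sub>i, u\<^sub>j\<rangle>\<close>, so that
  \<open>\<parallel>\<Sum>\<^sub>j cnj c\<^sub>j w\<^sub>j\<parallel>\<^sup>2 = \<Sum>\<^sub>i |\<langle>\<Sum>\<^sub>j c\<^sub>j u\<^sub>j, g\<^sub>i\<rangle>|\<^sup>2 \<le> B \<parallel>\<Sum>\<^sub>j c\<^sub>j u\<^sub>j\<parallel>\<^sup>2\<close>. By the duality principle for
  Gabor systems the left-hand side is at least \<open>A \<Sum>\<^sub>j |c\<^sub>j|\<^sup>2\<close>. Hence \<open>u\<close> is a Parseval frame that is also a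
  Riesz sequence, that is, an orthonormal basis.

  If \<open>w\<close> is total, it is a frame, and the duality principle for the lattice \<open>(1/b, 1/a)\<close> shows that \<open>g\<close> is a
  Riesz sequence; by symmetry \<open>v\<close> is an orthonormal basis as well. Otherwise the orthogonal complement of \<open>w\<close> is
  non-zero and invariant under translation by \<open>1/b\<close>, hence infinite-dimensional. The isometry
  \<open>x \<mapsto> \<Sum>\<^sub>i \<langle>x, v\<^sub>i\<rangle> u\<^sub>i\<close> on the closed span of \<open>w\<close> then extends to a unitary operator on \<open>L\<^sup>2(\<real>)\<close>,
  and its adjoint turns \<open>u\<close> into an orthonormal basis that can replace \<open>v\<close>.
\<close>

section \<open>The space of square integrable functions\<close>

text \<open>The relation between \<open>w\<close> and \<open>g\<close> keeps its form when
  \<open>(w, u)\<close> and \<open>(g, v)\<close> trade places, so the argument that makes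
  \<open>u\<close> orthonormal also works for \<open>v\<close> as soon as \<open>g\<close> has a
  lower Riesz bound. One implication of the duality principle, from a lower frame bound to a lower
  Riesz bound, serves both times. The obstacle is the case in which \<open>w\<close> is not total:
  the relation then determines only the projections of the \<open>v i\<close> onto the closed span
  of \<open>w\<close>. Extending an isometry from that span to a unitary operator requires
  complements of equal dimension in source and target. The isometry given by \<open>v\<close> and
  \<open>u\<close> is defined on the whole space and embeds the first complement into the second,
  which is only one inequality. Translation invariance makes the first complement
  infinite-dimensional, hence the second too, and separability makes both dimensions countable. The
  duality principle is proved by testing the frame bound on functions built from the
  coefficients.\<close>

lemma L2_measurable [measurable_dest]: "x \<in> L2 \<Longrightarrow> x \<in> borel_measurable borel"
  by (simp add: L2_def)

lemma borel_measurable_cnj [measurable (raw)]: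
  assumes "x \<in> borel_measurable M" shows "(\<lambda>t. cnj (x t)) \<in> borel_measurable M"
  using measurable_compose[OF assms borel_measurable_continuous_onI[of cnj]]
  by (simp add: continuous_on_cnj)

lemma L2_integrable_square: "x \<in> L2 \<Longrightarrow> integrable lborel (\<lambda>t. (cmod (x t))\<^sup>2)"
  by (simp add: L2_def)

lemma L2_I_bound:
  assumes "x \<in> borel_measurable lborel" "integrable lborel g" "\<And>t. (cmod (x t))\<^sup>2 \<le> g t"
  shows "x \<in> L2"
proof -
  note [measurable] = assms(1)
  have "integrable lborel (\<lambda>t. (cmod (x t))\<^sup>2)"
    by (rule Bochner_Integration.integrable_bound[OF assms(2)])
       (auto intro!: AE_I2 order_trans[OF assms(3)])
  then show ?thesis using assms(1) by (simp add: L2_def)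
qed

lemma L2_zero [simp]: "(\<lambda>t. 0) \<in> L2"
  by (simp add: L2_def)

lemma L2_scale [simp]:
  assumes "x \<in> L2" shows "(\<lambda>t. c * x t) \<in> L2"
proof -
  note [measurable] = L2_measurable[OF assms]
  show ?thesis using L2_integrable_square[OF assms]
    by (auto simp: L2_def norm_mult power_mult_distrib)
qed

lemma cmod_add_square_le: "(cmod (x + y))\<^sup>2 \<le> 2 * (cmod x)\<^sup>2 + 2 * (cmod y)\<^sup>2"
proof -
  have "(cmod (x + y))\<^sup>2 \<le> (cmod x + cmod y)\<^sup>2"
    by (intro power_mono norm_triangle_ineq) auto
  also have "\<dots> \<le> 2 * (cmod x)\<^sup>2 + 2 * (cmod y)\<^sup>2"
    using sum_squares_bound[of "cmod x" "cmod y"] by (simp add: power2_sum)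
  finally show ?thesis .
qed

lemma L2_add [simp]:
  assumes "x \<in> L2" "y \<in> L2" shows "(\<lambda>t. x t + y t) \<in> L2"
proof (rule L2_I_bound)
  show "(\<lambda>t. x t + y t) \<in> borel_measurable lborel"
    using assms by measurable
  show "integrable lborel (\<lambda>t. 2 * (cmod (x t))\<^sup>2 + 2 * (cmod (y t))\<^sup>2)"
    by (intro Bochner_Integration.integrable_add integrable_mult_right L2_integrable_square assms)
qed (rule cmod_add_square_le)

lemma L2_diff [simp]:
  assumes "x \<in> L2" "y \<in> L2" shows "(\<lambda>t. x t - y t) \<in> L2"
  using L2_add[OF assms(1) L2_scale[OF assms(2), of "-1"]] by simp

lemma L2_sum [simp]:
  assumes "\<And>s. s \<in> F \<Longrightarrow> x s \<in> L2" shows "(\<lambda>t. \<Sum>s\<in>F. x s t) \<in> L2"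
  using assms by (induction F rule: infinite_finite_induct) auto

lemma L2_cnj [simp]:
  assumes "x \<in> L2" shows "(\<lambda>t. cnj (x t)) \<in> L2"
  using assms by (auto simp: L2_def intro: borel_measurable_cnj)

lemma L2_restrict:
  assumes "x \<in> L2" "A \<in> sets lborel" shows "(\<lambda>t. indicator A t * x t) \<in> L2"
proof (rule L2_I_bound)
  show "(\<lambda>t. indicator A t * x t) \<in> borel_measurable lborel"
    using assms by measurable
  show "integrable lborel (\<lambda>t. (cmod (x t))\<^sup>2)"
    using assms(1) by (rule L2_integrable_square)
qed (auto simp: indicator_def)

lemma L2_bounded_mult:
  assumes "x \<in> L2" "m \<in> borel_measurable lborel" "\<And>t. cmod (m t) \<le> C"
  shows "(\<lambda>t. m t * x t) \<in> L2"
proof (rule L2_I_bound)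
  show "(\<lambda>t. m t * x t) \<in> borel_measurable lborel"
    using assms by measurable
  show "integrable lborel (\<lambda>t. C\<^sup>2 * (cmod (x t))\<^sup>2)"
    using L2_integrable_square[OF assms(1)] by auto
  show "(cmod (m t * x t))\<^sup>2 \<le> C\<^sup>2 * (cmod (x t))\<^sup>2" for t
    using assms(3)[of t] by (auto simp: norm_mult power_mult_distrib intro!: mult_right_mono power_mono)
qed

lemma L2_inner_integrable:
  assumes "x \<in> L2" "y \<in> L2" shows "integrable lborel (\<lambda>t. x t * cnj (y t))"
proof (rule Bochner_Integration.integrable_bound)
  show "integrable lborel (\<lambda>t. (cmod (x t))\<^sup>2 + (cmod (y t))\<^sup>2)"
    using assms by (auto intro: L2_integrable_square)
  show "(\<lambda>t. x t * cnj (y t)) \<in> borel_measurable lborel"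
    using assms by measurable
  have "cmod (x t) * cmod (y t) \<le> (cmod (x t))\<^sup>2 + (cmod (y t))\<^sup>2" for t
    using sum_squares_bound[of "cmod (x t)" "cmod (y t)"]
      mult_nonneg_nonneg[OF norm_ge_zero[of "x t"] norm_ge_zero[of "y t"]] by linarith
  then show "AE t in lborel. norm (x t * cnj (y t)) \<le> norm ((cmod (x t))\<^sup>2 + (cmod (y t))\<^sup>2)"
    by (auto simp: norm_mult)
qed

section \<open>Inner product and seminorm\<close>

lemma L2_inner_add_left:
  assumes "x \<in> L2" "y \<in> L2" "z \<in> L2"
  shows "L2_inner (\<lambda>t. x t + y t) z = L2_inner x z + L2_inner y z"
  unfolding L2_inner_def using L2_inner_integrable[OF assms(1,3)] L2_inner_integrable[OF assms(2,3)]
  by (simp add: distrib_right)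

lemma L2_inner_scale_left: "L2_inner (\<lambda>t. c * x t) z = c * L2_inner x z"
  by (simp add: L2_inner_def mult.assoc)

lemma L2_inner_cnj: "cnj (L2_inner x y) = L2_inner y x"
  by (simp add: L2_inner_def mult.commute flip: Bochner_Integration.integral_cnj)

lemma L2_inner_norm_commute: "cmod (L2_inner x y) = cmod (L2_inner y x)"
  by (metis L2_inner_cnj complex_mod_cnj)

lemma L2_inner_diff_left:
  assumes "x \<in> L2" "y \<in> L2" "z \<in> L2"
  shows "L2_inner (\<lambda>t. x t - y t) z = L2_inner x z - L2_inner y z"
  unfolding L2_inner_def using L2_inner_integrable[OF assms(1,3)] L2_inner_integrable[OF assms(2,3)]
  by (simp add: left_diff_distrib)

lemma L2_inner_diff_right:
  assumes "x \<in> L2" "y \<in> L2" "z \<in> L2"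
  shows "L2_inner z (\<lambda>t. x t - y t) = L2_inner z x - L2_inner z y"
  by (metis L2_inner_cnj L2_inner_diff_left[OF assms] complex_cnj_diff)

lemma L2_inner_zero_left [simp]: "L2_inner (\<lambda>t. 0) x = 0"
  by (simp add: L2_inner_def)

lemma L2_inner_sum_left:
  assumes "\<And>s. s \<in> F \<Longrightarrow> x s \<in> L2" "z \<in> L2"
  shows "L2_inner (\<lambda>t. \<Sum>s\<in>F. x s t) z = (\<Sum>s\<in>F. L2_inner (x s) z)"
  using assms by (induction F rule: infinite_finite_induct) (auto simp: L2_inner_add_left)

lemma L2_norm_nonneg [simp]: "0 \<le> L2_norm x"
  by (simp add: L2_norm_def)

lemma L2_norm_square: "(L2_norm x)\<^sup>2 = (\<integral>t. (cmod (x t))\<^sup>2 \<partial>lborel)"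
  by (simp add: L2_norm_def)

lemma L2_inner_self: "L2_inner x x = of_real ((L2_norm x)\<^sup>2)"
  unfolding L2_norm_square L2_inner_def integral_complex_of_real[symmetric] complex_norm_square ..

lemma L2_norm_square_diff:
  assumes "x \<in> L2" "y \<in> L2"
  shows "(L2_norm (\<lambda>t. x t - y t))\<^sup>2 = (L2_norm x)\<^sup>2 - 2 * Re (L2_inner x y) + (L2_norm y)\<^sup>2"
proof -
  have "complex_of_real ((L2_norm (\<lambda>t. x t - y t))\<^sup>2)
      = L2_inner x x - L2_inner x y - (cnj (L2_inner x y) - L2_inner y y)"
    unfolding L2_inner_self[symmetric] L2_inner_cnj
    using assms by (simp add: L2_inner_diff_left L2_inner_diff_right)
  also have "\<dots> = of_real ((L2_norm x)\<^sup>2 - 2 * Re (L2_inner x y) + (L2_norm y)\<^sup>2)"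
    unfolding L2_inner_self by (simp add: complex_eq_iff)
  finally show ?thesis by (simp only: of_real_eq_iff)
qed

lemma L2_norm_scale: "L2_norm (\<lambda>t. c * x t) = cmod c * L2_norm x"
  by (simp add: L2_norm_def norm_mult power_mult_distrib real_sqrt_mult)

lemma L2_norm_minus_commute: "L2_norm (\<lambda>t. x t - y t) = L2_norm (\<lambda>t. y t - x t)"
  by (simp add: L2_norm_def norm_minus_commute)

text \<open>The squared norm of \<open>x - r c y\<close>, with \<open>c\<close> the inner product,
  is non-negative for every real \<open>r\<close>. Since \<open>L2_norm\<close> is only a seminorm
  on functions, \<open>L2_norm y = 0\<close> does not give \<open>y = 0\<close>, and this case is
  refuted through the choice of \<open>r\<close>.\<close>

lemma L2_Cauchy_Schwarz:
  assumes "x \<in> L2" "y \<in> L2"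
  shows "cmod (L2_inner x y) \<le> L2_norm x * L2_norm y"
proof -
  define c where "c = L2_inner x y"
  have le: "2 * r * (cmod c)\<^sup>2 \<le> (L2_norm x)\<^sup>2 + r\<^sup>2 * (cmod c)\<^sup>2 * (L2_norm y)\<^sup>2" for r :: real
  proof -
    have "L2_inner x (\<lambda>t. of_real r * c * y t) = of_real (r * (cmod c)\<^sup>2)"
      by (subst L2_inner_cnj[symmetric], subst L2_inner_scale_left, subst L2_inner_cnj[of x y, symmetric])
         (simp add: c_def complex_norm_square mult.commute del: of_real_power)
    then have "0 \<le> (L2_norm x)\<^sup>2 - 2 * (r * (cmod c)\<^sup>2) + (\<bar>r\<bar> * cmod c * L2_norm y)\<^sup>2"
      using L2_norm_square_diff[OF assms(1) L2_scale[OF assms(2), of "of_real r * c"]]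
        zero_le_power2[of "L2_norm (\<lambda>t. x t - of_real r * c * y t)"]
      by (simp add: L2_norm_scale norm_mult)
    then show ?thesis by (simp add: power_mult_distrib)
  qed
  show ?thesis
  proof (cases "c = 0")
    case True then show ?thesis by (simp add: c_def[symmetric])
  next
    case False
    show ?thesis
    proof (cases "L2_norm y = 0")
      case True
      \<comment> \<open>With \<open>L2_norm y = 0\<close> the inequality is linear in
        \<open>r\<close>, and this \<open>r\<close> exceeds the largest value that it
        admits.\<close>
      have "2 * ((L2_norm x)\<^sup>2 / (cmod c)\<^sup>2 + 1) * (cmod c)\<^sup>2 \<le> (L2_norm x)\<^sup>2"
        using le[of "(L2_norm x)\<^sup>2 / (cmod c)\<^sup>2 + 1"] True by simp
      then have "2 * (L2_norm x)\<^sup>2 + 2 * (cmod c)\<^sup>2 \<le> (L2_norm x)\<^sup>2"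
        using False by (simp add: algebra_simps)
      then show ?thesis using False zero_le_power2[of "L2_norm x"]
          by (smt (verit) zero_less_norm_iff zero_less_power)
    next
      case ny: False
      \<comment> \<open>The value of \<open>r\<close> that minimises the quadratic.\<close>
      have "2 * (1 / (L2_norm y)\<^sup>2) * (cmod c)\<^sup>2
          \<le> (L2_norm x)\<^sup>2 + (1 / (L2_norm y)\<^sup>2)\<^sup>2 * (cmod c)\<^sup>2 * (L2_norm y)\<^sup>2"
        by (rule le)
      moreover have "(1 / (L2_norm y)\<^sup>2)\<^sup>2 * (cmod c)\<^sup>2 * (L2_norm y)\<^sup>2 = (cmod c)\<^sup>2 / (L2_norm y)\<^sup>2"
        using ny by (simp add: power2_eq_square)
      ultimately have "(cmod c)\<^sup>2 / (L2_norm y)\<^sup>2 \<le> (L2_norm x)\<^sup>2" by simp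
      then have "(cmod c)\<^sup>2 \<le> (L2_norm x * L2_norm y)\<^sup>2"
        using ny by (simp add: pos_divide_le_eq power_mult_distrib)
      then show ?thesis unfolding c_def by (rule power2_le_imp_le) simp
    qed
  qed
qed

lemma L2_norm_triangle_diff:
  assumes "x \<in> L2" "y \<in> L2"
  shows "L2_norm (\<lambda>t. x t - y t) \<le> L2_norm x + L2_norm y"
proof (rule power2_le_imp_le)
  show "(L2_norm (\<lambda>t. x t - y t))\<^sup>2 \<le> (L2_norm x + L2_norm y)\<^sup>2"
    using L2_norm_square_diff[OF assms] L2_Cauchy_Schwarz[OF assms] abs_Re_le_cmod[of "L2_inner x y"]
    by (simp add: power2_sum)
qed simp

lemma L2_norm_triangle_mid:
  assumes "x \<in> L2" "y \<in> L2" "z \<in> L2"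
  shows "L2_norm (\<lambda>t. x t - z t) \<le> L2_norm (\<lambda>t. x t - y t) + L2_norm (\<lambda>t. y t - z t)"
  using L2_norm_triangle_diff[of "\<lambda>t. x t - y t" "\<lambda>t. z t - y t"] assms
  by (simp add: L2_norm_minus_commute[of z y])

lemma L2_norm_zero_inner:
  assumes "x \<in> L2" "y \<in> L2" "L2_norm x = 0" shows "L2_inner x y = 0"
  using L2_Cauchy_Schwarz[OF assms(1,2)] assms(3) by simp

definition lincomb :: "'i set \<Rightarrow> ('i \<Rightarrow> complex) \<Rightarrow> ('i \<Rightarrow> real \<Rightarrow> complex) \<Rightarrow> real \<Rightarrow> complex" where
  "lincomb F c e t = (\<Sum>s\<in>F. c s * e s t)"

lemma lincomb_L2 [simp]: "(\<And>s. s \<in> F \<Longrightarrow> e s \<in> L2) \<Longrightarrow> lincomb F c e \<in> L2"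
  unfolding lincomb_def[abs_def] by simp

lemma L2_inner_lincomb_left:
  assumes "\<And>s. s \<in> F \<Longrightarrow> e s \<in> L2" "x \<in> L2"
  shows "L2_inner (lincomb F c e) x = (\<Sum>s\<in>F. c s * L2_inner (e s) x)"
  unfolding lincomb_def[abs_def] using assms by (simp add: L2_inner_sum_left L2_inner_scale_left)

lemma L2_inner_lincomb_right:
  assumes "\<And>s. s \<in> F \<Longrightarrow> e s \<in> L2" "x \<in> L2"
  shows "L2_inner x (lincomb F c e) = (\<Sum>s\<in>F. cnj (c s) * L2_inner x (e s))"
  by (subst L2_inner_cnj[symmetric], subst L2_inner_lincomb_left[OF assms])
     (auto simp: L2_inner_cnj)

section \<open>Completeness and norm convergent expansions\<close>

text \<open>The squared increments, weighted by \<open>2 ^ n\<close>, have integrals at most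
  \<open>(1/2) ^ n\<close>. Their sum is therefore finite almost everywhere, which forces pointwise
  convergence there; Fatou's lemma then carries the norm bounds over to the limit.\<close>

lemma L2_complete:
  assumes X: "\<And>n. X n \<in> L2"
    and cauchy: "\<And>m n. n \<le> m \<Longrightarrow> (L2_norm (\<lambda>t. X m t - X n t))\<^sup>2 \<le> (1/4) ^ n"
  obtains y where "y \<in> L2" "\<And>n. (L2_norm (\<lambda>t. y t - X n t))\<^sup>2 \<le> (1/4) ^ n"
proof -
  note [measurable] = L2_measurable[OF X]
  have nn: "(\<integral>\<^sup>+t. ennreal ((cmod (x t))\<^sup>2) \<partial>lborel) = ennreal ((L2_norm x)\<^sup>2)" if "x \<in> L2" for x
    unfolding L2_norm_square
    by (rule nn_integral_eq_integral) (auto simp: L2_integrable_square that)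
  define g where "g n t = cmod (X (Suc n) t - X n t)" for n t
  have [measurable]: "g n \<in> borel_measurable borel" for n
    unfolding g_def by measurable
  have "(\<integral>\<^sup>+t. (\<Sum>n. ennreal (2 ^ n * (g n t)\<^sup>2)) \<partial>lborel)
      = (\<Sum>n. \<integral>\<^sup>+t. ennreal (2 ^ n * (g n t)\<^sup>2) \<partial>lborel)"
    by (rule nn_integral_suminf) measurable
  also have "\<dots> \<le> (\<Sum>n. ennreal ((1/2) ^ n))"
  proof (rule suminf_le)
    fix n
    have "(\<integral>\<^sup>+t. ennreal (2 ^ n * (g n t)\<^sup>2) \<partial>lborel)
        = ennreal (2 ^ n) * ennreal ((L2_norm (\<lambda>t. X (Suc n) t - X n t))\<^sup>2)"
      by (simp add: ennreal_mult nn_integral_cmult nn X g_def)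
    also have "\<dots> \<le> ennreal (2 ^ n) * ennreal ((1/4) ^ n)"
      by (intro mult_left_mono ennreal_leI cauchy) auto
    also have "\<dots> = ennreal ((1/2) ^ n)"
      by (simp flip: ennreal_mult power_mult_distrib)
    finally show "(\<integral>\<^sup>+t. ennreal (2 ^ n * (g n t)\<^sup>2) \<partial>lborel) \<le> ennreal ((1/2) ^ n)" .
  qed auto
  also have "\<dots> = ennreal 2"
    using power_half_series sums_mult[OF power_half_series, of 2]
    by (intro suminf_ennreal_eq) auto
  finally have "(\<integral>\<^sup>+t. (\<Sum>n. ennreal (2 ^ n * (g n t)\<^sup>2)) \<partial>lborel) \<noteq> \<infinity>"
    by (auto simp: top_unique)
  then have AEfin: "AE t in lborel. (\<Sum>n. ennreal (2 ^ n * (g n t)\<^sup>2)) \<noteq> \<infinity>"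
    by (intro nn_integral_PInf_AE) measurable
  have conv: "convergent (\<lambda>n. X n t)" if fin: "(\<Sum>n. ennreal (2 ^ n * (g n t)\<^sup>2)) \<noteq> \<infinity>" for t
  proof -
    have "summable (\<lambda>n. 2 ^ n * (g n t)\<^sup>2)"
      using fin by (intro summable_suminf_not_top) auto
    then have "summable (\<lambda>n. 2 ^ n * (g n t)\<^sup>2 + (1/2) ^ n)"
      by (intro summable_add) auto
    then have "summable (\<lambda>n. X (Suc n) t - X n t)"
    proof (rule summable_comparison_test'[where N = 0])
      fix n
      \<comment> \<open>AM-GM for \<open>2\<^bsup>n/2\<^esup> g\<close> and \<open>2\<^bsup>-n/2\<^esup>\<close>\<close>
      have "0 \<le> 2 ^ n * (g n t - (1/2) ^ n)\<^sup>2" by simp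
      also have "\<dots> = 2 ^ n * (g n t)\<^sup>2 - 2 * g n t + (1/2) ^ n"
        by (simp add: power2_diff algebra_simps power2_eq_square power_divide)
      finally show "norm (X (Suc n) t - X n t) \<le> 2 ^ n * (g n t)\<^sup>2 + (1/2) ^ n"
        by (simp add: g_def)
           (smt (verit) norm_ge_zero zero_le_power zero_le_divide_1_iff)
    qed
    then have "convergent (\<lambda>n. X n t - X 0 t)"
      by (simp add: summable_iff_convergent sum_lessThan_telescope[of "\<lambda>n. X n t"])
    from convergent_add[OF this convergent_const[of "X 0 t"]] show ?thesis by simp
  qed
  have AEconv: "AE t in lborel. (\<lambda>n. X n t) \<longlonglongrightarrow> lim (\<lambda>n. X n t)"
    using AEfin by eventually_elim (simp add: conv flip: convergent_LIMSEQ_iff)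
  \<comment> \<open>The value of \<open>lim\<close> at points of divergence is immaterial, as these
    form a null set.\<close>
  define y where "y t = lim (\<lambda>n. X n t)" for t
  have [measurable]: "y \<in> borel_measurable borel"
    unfolding y_def by measurable
  have le: "(\<integral>\<^sup>+t. ennreal ((cmod (y t - X n t))\<^sup>2) \<partial>lborel) \<le> ennreal ((1/4) ^ n)" for n
  proof -
    have "AE t in lborel. ennreal ((cmod (y t - X n t))\<^sup>2)
        = liminf (\<lambda>m. ennreal ((cmod (X m t - X n t))\<^sup>2))"
      using AEconv
    proof eventually_elim
      case (elim t)
      then have "(\<lambda>m. ennreal ((cmod (X m t - X n t))\<^sup>2)) \<longlonglongrightarrow> ennreal ((cmod (y t - X n t))\<^sup>2)"
        unfolding y_def[symmetric] by (intro tendsto_intros) auto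
      then show ?case by (intro lim_imp_Liminf[symmetric]) auto
    qed
    then have "(\<integral>\<^sup>+t. ennreal ((cmod (y t - X n t))\<^sup>2) \<partial>lborel)
        = (\<integral>\<^sup>+t. liminf (\<lambda>m. ennreal ((cmod (X m t - X n t))\<^sup>2)) \<partial>lborel)"
      by (rule nn_integral_cong_AE)
    also have "\<dots> \<le> liminf (\<lambda>m. \<integral>\<^sup>+t. ennreal ((cmod (X m t - X n t))\<^sup>2) \<partial>lborel)"
      by (rule nn_integral_liminf) measurable
    also have "\<dots> \<le> liminf (\<lambda>m. ennreal ((1/4) ^ n))"
      by (intro Liminf_mono eventually_sequentiallyI[of n])
         (use cauchy in \<open>simp add: nn X ennreal_leI\<close>)
    finally show ?thesis by (simp add: Liminf_const)
  qed
  have diff: "(\<lambda>t. y t - X n t) \<in> L2" for n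
  proof -
    have "(\<integral>\<^sup>+t. ennreal ((cmod (y t - X n t))\<^sup>2) \<partial>lborel) < \<infinity>"
      using le[of n] by (simp add: order_le_less_trans)
    then have "integrable lborel (\<lambda>t. (cmod (y t - X n t))\<^sup>2)"
      by (intro integrableI_nonneg) auto
    then show ?thesis by (simp add: L2_def)
  qed
  show ?thesis
  proof
    show "y \<in> L2" using L2_add[OF diff[of 0] X[of 0]] by simp
    show "(L2_norm (\<lambda>t. y t - X n t))\<^sup>2 \<le> (1/4) ^ n" for n
      using le[of n] by (simp add: nn diff)
  qed
qed

text \<open>Quantifying over finite subsets lets one notion cover frames over a countable index type
  and orthonormal sets indexed by themselves, whose countability is not known in advance.\<close>

definition bessel :: "real \<Rightarrow> 'i set \<Rightarrow> ('i \<Rightarrow> real \<Rightarrow> complex) \<Rightarrow> bool" where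
  "bessel B S e \<longleftrightarrow> 0 \<le> B \<and> e ` S \<subseteq> L2 \<and>
     (\<forall>x\<in>L2. \<forall>F. finite F \<longrightarrow> F \<subseteq> S \<longrightarrow> (\<Sum>s\<in>F. (cmod (L2_inner x (e s)))\<^sup>2) \<le> B * (L2_norm x)\<^sup>2)"

definition L2_sum_on :: "'i set \<Rightarrow> ('i \<Rightarrow> complex) \<Rightarrow> ('i \<Rightarrow> real \<Rightarrow> complex) \<Rightarrow> (real \<Rightarrow> complex) \<Rightarrow> bool" where
  "L2_sum_on S c e y \<longleftrightarrow>
     ((\<lambda>F. L2_norm (\<lambda>t. y t - lincomb F c e t)) \<longlongrightarrow> 0) (finite_subsets_at_top S)"

lemma besselD_L2: "bessel B S e \<Longrightarrow> s \<in> S \<Longrightarrow> e s \<in> L2"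
  by (auto simp: bessel_def)

text \<open>Synthesis is adjoint to analysis and has the same bound: pair the combination with
  itself, apply Cauchy-Schwarz to the coefficients, and cancel one factor of its squared
  norm.\<close>

lemma L2_norm_lincomb_le:
  assumes be: "bessel B S e" and F: "finite F" "F \<subseteq> S"
  shows "(L2_norm (lincomb F c e))\<^sup>2 \<le> B * (\<Sum>s\<in>F. (cmod (c s))\<^sup>2)"
proof -
  define y where "y = lincomb F c e"
  define C where "C = (\<Sum>s\<in>F. (cmod (c s))\<^sup>2)"
  define N where "N = (L2_norm y)\<^sup>2"
  have N: "0 \<le> N" by (simp add: N_def)
  have C: "0 \<le> C" unfolding C_def by (intro sum_nonneg zero_le_power2)
  have eL: "\<And>s. s \<in> F \<Longrightarrow> e s \<in> L2" using F besselD_L2[OF be] by blast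
  have y: "y \<in> L2" unfolding y_def using eL by (rule lincomb_L2)
  have "L2_inner y y = (\<Sum>s\<in>F. c s * L2_inner (e s) y)"
    using L2_inner_lincomb_left[OF eL y, where c = c] unfolding y_def .
  from arg_cong[OF this, of cmod]
  have "N = cmod (\<Sum>s\<in>F. c s * L2_inner (e s) y)"
    unfolding L2_inner_self N_def by (simp only: norm_of_real abs_power2)
  also have "\<dots> \<le> (\<Sum>s\<in>F. cmod (c s) * cmod (L2_inner y (e s)))"
    by (rule order_trans[OF norm_sum]) (simp add: norm_mult L2_inner_norm_commute[of _ y])
  finally have "N\<^sup>2 \<le> (\<Sum>s\<in>F. cmod (c s) * cmod (L2_inner y (e s)))\<^sup>2"
    using N by (rule power_mono)
  also have "\<dots> \<le> C * (\<Sum>s\<in>F. (cmod (L2_inner y (e s)))\<^sup>2)"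
    unfolding C_def by (rule Cauchy_Schwarz_ineq_sum)
  also have "\<dots> \<le> C * (B * N)"
    using be y F C unfolding bessel_def N_def by (intro mult_left_mono) blast+
  finally have *: "N * N \<le> (B * C) * N"
    by (simp only: power2_eq_square mult.commute mult.left_commute)
  have "0 \<le> B * C" using be C by (simp add: bessel_def)
  then have "N \<le> B * C" using * N by (cases "N = 0") (auto simp: mult_le_cancel_right)
  then show ?thesis by (simp add: N_def C_def y_def)
qed

text \<open>The adjoint argument in the other direction: the bound on combinations is tested with
  the coefficients \<open>L2_inner x (e s)\<close>, and one factor of their square sum
  cancels.\<close>

lemma besselI:
  assumes eL: "\<And>s. s \<in> S \<Longrightarrow> e s \<in> L2" and "0 \<le> B"
    and le: "\<And>F c. finite F \<Longrightarrow> F \<subseteq> S \<Longrightarrow> (L2_norm (lincomb F c e))\<^sup>2 \<le> B * (\<Sum>s\<in>F. (cmod (c s))\<^sup>2)"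
  shows "bessel B S e"
  unfolding bessel_def
proof (intro conjI ballI allI impI)
  fix x F assume x: "x \<in> L2" and F: "finite F" "F \<subseteq> S"
  define Q where "Q = (\<Sum>s\<in>F. (cmod (L2_inner x (e s)))\<^sup>2)"
  define y where "y = lincomb F (\<lambda>s. L2_inner x (e s)) e"
  have y: "y \<in> L2" unfolding y_def using eL F by (intro lincomb_L2) auto
  have "L2_inner x y = (\<Sum>s\<in>F. cnj (L2_inner x (e s)) * L2_inner x (e s))"
    unfolding y_def using eL F x by (intro L2_inner_lincomb_right) auto
  also have "\<dots> = of_real Q"
    by (simp add: Q_def complex_norm_square mult.commute del: of_real_power)
  finally have "Q = cmod (L2_inner x y)" by (simp only: norm_of_real) (simp add: Q_def sum_nonneg)
  also have "\<dots> \<le> L2_norm x * L2_norm y" using x y by (rule L2_Cauchy_Schwarz)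
  finally have "Q\<^sup>2 \<le> (L2_norm x * L2_norm y)\<^sup>2"
    by (intro power_mono) (auto simp: Q_def sum_nonneg)
  also have "\<dots> \<le> (L2_norm x)\<^sup>2 * (B * Q)"
    unfolding power_mult_distrib y_def Q_def by (intro mult_left_mono le F) auto
  finally have "Q * Q \<le> (B * (L2_norm x)\<^sup>2) * Q"
    by (simp add: power2_eq_square algebra_simps)
  moreover have "0 \<le> Q" by (simp add: Q_def sum_nonneg)
  ultimately have "Q \<le> B * (L2_norm x)\<^sup>2"
    using \<open>0 \<le> B\<close> by (cases "Q = 0") (auto simp: mult_le_cancel_right)
  then show "(\<Sum>s\<in>F. (cmod (L2_inner x (e s)))\<^sup>2) \<le> B * (L2_norm x)\<^sup>2" by (simp add: Q_def)
next
  show "0 \<le> B" by fact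
  show "e ` S \<subseteq> L2" using eL by blast
qed

lemma L2_sum_on_inner:
  assumes sm: "L2_sum_on S c e y" and eL: "\<And>s. s \<in> S \<Longrightarrow> e s \<in> L2" and "y \<in> L2" "x \<in> L2"
  shows "((\<lambda>s. c s * L2_inner (e s) x) has_sum L2_inner y x) S"
  unfolding has_sum_def
proof (rule LIM_zero_cancel, rule tendsto_0_le[where K = "L2_norm x"])
  show "((\<lambda>F. L2_norm (\<lambda>t. y t - lincomb F c e t)) \<longlongrightarrow> 0) (finite_subsets_at_top S)"
    using sm by (simp add: L2_sum_on_def)
  show "\<forall>\<^sub>F F in finite_subsets_at_top S. norm ((\<Sum>s\<in>F. c s * L2_inner (e s) x) - L2_inner y x)
      \<le> norm (L2_norm (\<lambda>t. y t - lincomb F c e t)) * L2_norm x"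
  proof (rule eventually_finite_subsets_at_top_weakI)
    fix F assume F: "finite F" "F \<subseteq> S"
    then have eF: "\<And>s. s \<in> F \<Longrightarrow> e s \<in> L2" using eL by auto
    have "L2_inner (\<lambda>t. y t - lincomb F c e t) x = L2_inner y x - (\<Sum>s\<in>F. c s * L2_inner (e s) x)"
      using assms eF by (simp add: L2_inner_diff_left L2_inner_lincomb_left)
    then show "norm ((\<Sum>s\<in>F. c s * L2_inner (e s) x) - L2_inner y x)
      \<le> norm (L2_norm (\<lambda>t. y t - lincomb F c e t)) * L2_norm x"
      using L2_Cauchy_Schwarz[of "\<lambda>t. y t - lincomb F c e t" x] assms eF
      by (simp add: norm_minus_commute)
  qed
qed

text \<open>Let \<open>Q\<close> be a partial sum of the squared coefficients. In the squared error
  the cross term contributes \<open>- 2 * Q\<close> and the synthesis bound at most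
  \<open>Q\<close>, so Parseval's identity for this one \<open>x\<close> forces convergence. This
  covers Parseval frames as well as orthonormal families.\<close>

lemma L2_sum_on_expansion:
  assumes be: "bessel 1 S e" and x: "x \<in> L2"
    and pars: "((\<lambda>s. (cmod (L2_inner x (e s)))\<^sup>2) has_sum (L2_norm x)\<^sup>2) S"
  shows "L2_sum_on S (\<lambda>s. L2_inner x (e s)) e x"
proof -
  have le: "(L2_norm (\<lambda>t. x t - lincomb F (\<lambda>s. L2_inner x (e s)) e t))\<^sup>2
      \<le> (L2_norm x)\<^sup>2 - (\<Sum>s\<in>F. (cmod (L2_inner x (e s)))\<^sup>2)" if F: "finite F" "F \<subseteq> S" for F
  proof -
    have eL: "\<And>s. s \<in> F \<Longrightarrow> e s \<in> L2" using besselD_L2[OF be] F by auto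
    have "L2_inner x (lincomb F (\<lambda>s. L2_inner x (e s)) e) = (\<Sum>s\<in>F. cnj (L2_inner x (e s)) * L2_inner x (e s))"
      using eL x by (rule L2_inner_lincomb_right)
    also have "\<dots> = of_real (\<Sum>s\<in>F. (cmod (L2_inner x (e s)))\<^sup>2)"
      by (simp add: complex_norm_square mult.commute del: of_real_power)
    finally have "Re (L2_inner x (lincomb F (\<lambda>s. L2_inner x (e s)) e)) = (\<Sum>s\<in>F. (cmod (L2_inner x (e s)))\<^sup>2)"
      by simp
    then show ?thesis
      using L2_norm_square_diff[OF x lincomb_L2[of F e "\<lambda>s. L2_inner x (e s)", OF eL]]
        L2_norm_lincomb_le[OF be F, of "\<lambda>s. L2_inner x (e s)"] by simp
  qed
  have "((\<lambda>F. (L2_norm (\<lambda>t. x t - lincomb F (\<lambda>s. L2_inner x (e s)) e t))\<^sup>2) \<longlongrightarrow> 0) (finite_subsets_at_top S)"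
  proof (rule tendsto_sandwich[OF _ _ tendsto_const])
    show "((\<lambda>F. (L2_norm x)\<^sup>2 - (\<Sum>s\<in>F. (cmod (L2_inner x (e s)))\<^sup>2)) \<longlongrightarrow> 0) (finite_subsets_at_top S)"
      using tendsto_diff[OF tendsto_const pars[unfolded has_sum_def], of "(L2_norm x)\<^sup>2"] by simp
    show "\<forall>\<^sub>F F in finite_subsets_at_top S. 0 \<le> (L2_norm (\<lambda>t. x t - lincomb F (\<lambda>s. L2_inner x (e s)) e t))\<^sup>2"
      by (intro always_eventually allI zero_le_power2)
    show "\<forall>\<^sub>F F in finite_subsets_at_top S. (L2_norm (\<lambda>t. x t - lincomb F (\<lambda>s. L2_inner x (e s)) e t))\<^sup>2
        \<le> (L2_norm x)\<^sup>2 - (\<Sum>s\<in>F. (cmod (L2_inner x (e s)))\<^sup>2)"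
      by (rule eventually_finite_subsets_at_top_weakI) (rule le)
  qed
  from tendsto_real_sqrt[OF this] show ?thesis by (simp add: L2_sum_on_def)
qed

lemma L2_sum_on_norm:
  assumes "L2_sum_on S c e y" "\<And>s. s \<in> S \<Longrightarrow> e s \<in> L2" "y \<in> L2" "\<epsilon> > 0"
  shows "\<exists>F. finite F \<and> F \<subseteq> S \<and> L2_norm (\<lambda>t. y t - lincomb F c e t) < \<epsilon>"
proof -
  have "\<forall>\<^sub>F F in finite_subsets_at_top S. L2_norm (\<lambda>t. y t - lincomb F c e t) < \<epsilon>"
    using assms(1,4) unfolding L2_sum_on_def by (rule order_tendstoD)
  then show ?thesis unfolding eventually_finite_subsets_at_top by blast
qed

lemma summable_on_tail:
  fixes q :: "'i \<Rightarrow> real"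
  assumes "q summable_on S" "\<epsilon> > 0" "\<And>s. 0 \<le> q s"
  shows "\<exists>F. finite F \<and> F \<subseteq> S \<and> (\<forall>G. finite G \<longrightarrow> G \<subseteq> S \<longrightarrow> G \<inter> F = {} \<longrightarrow> sum q G \<le> \<epsilon>)"
proof -
  have "(sum q \<longlongrightarrow> infsum q S) (finite_subsets_at_top S)"
    using assms(1) infsum_tendsto by blast
  then have "\<forall>\<^sub>F F in finite_subsets_at_top S. infsum q S - \<epsilon> < sum q F"
    using assms(2) by (intro order_tendstoD) auto
  then obtain F where F: "finite F" "F \<subseteq> S" "infsum q S - \<epsilon> < sum q F"
    unfolding eventually_finite_subsets_at_top by blast
  have "sum q G \<le> \<epsilon>" if "finite G" "G \<subseteq> S" "G \<inter> F = {}" for G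
  proof -
    have "sum q G + sum q F = sum q (G \<union> F)" using that F by (simp add: sum.union_disjoint)
    also have "\<dots> \<le> infsum q S" using that F assms by (intro finite_sum_le_infsum) auto
    finally show ?thesis using F(3) by simp
  qed
  then show ?thesis using F by blast
qed

text \<open>Small coefficient tails yield finite sets along which the partial sums form a rapid
  Cauchy sequence. The synthesis bound shows that the whole net of finite partial sums has the same
  limit.\<close>

lemma L2_Riesz_Fischer:
  assumes be: "bessel 1 S e" and c: "(\<lambda>s. (cmod (c s))\<^sup>2) summable_on S"
  obtains y where "y \<in> L2" "L2_sum_on S c e y"
proof -
  define good where "good \<delta> F \<longleftrightarrow> finite F \<and> F \<subseteq> S \<and>
      (\<forall>G. finite G \<longrightarrow> G \<subseteq> S \<longrightarrow> G \<inter> F = {} \<longrightarrow> (\<Sum>s\<in>G. (cmod (c s))\<^sup>2) \<le> \<delta>)" for \<delta> F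
  have "\<forall>n. \<exists>F. good ((1/4) ^ n) F"
    unfolding good_def by (intro allI summable_on_tail c) auto
  then obtain P where P: "\<And>n. good ((1/4) ^ n) (P n)" by metis
  \<comment> \<open>The sets \<open>P n\<close> need not be nested. Their unions are, and enlarging
    a set keeps it good for the same tolerance.\<close>
  define Q where "Q n = (\<Union>k\<le>n. P k)" for n
  have Q: "good ((1/4) ^ n) (Q n)" for n
  proof -
    have 1: "P n \<subseteq> Q n" unfolding Q_def by auto
    have 2: "finite (Q n)" "Q n \<subseteq> S" using P unfolding good_def Q_def by auto
    show ?thesis unfolding good_def
    proof (intro conjI allI impI 2)
      fix G assume "finite G" "G \<subseteq> S" "G \<inter> Q n = {}"
      moreover from this have "G \<inter> P n = {}" using 1 by blast
      ultimately show "(\<Sum>s\<in>G. (cmod (c s))\<^sup>2) \<le> (1/4) ^ n"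
        using P[of n] unfolding good_def by blast
    qed
  qed
  have Qmono: "Q n \<subseteq> Q m" if "n \<le> m" for n m using that by (auto simp: Q_def intro: order_trans)
  have lin: "(L2_norm (\<lambda>t. lincomb F c e t - lincomb (Q n) c e t))\<^sup>2 \<le> (1/4) ^ n"
    if F: "finite F" "F \<subseteq> S" "Q n \<subseteq> F" for F n
  proof -
    have "(\<lambda>t. lincomb F c e t - lincomb (Q n) c e t) = lincomb (F - Q n) c e"
      using F Q[of n] by (auto simp: lincomb_def fun_eq_iff sum_diff good_def)
    then have "(L2_norm (\<lambda>t. lincomb F c e t - lincomb (Q n) c e t))\<^sup>2 \<le> 1 * (\<Sum>s\<in>F - Q n. (cmod (c s))\<^sup>2)"
      using L2_norm_lincomb_le[OF be, of "F - Q n" c] F by auto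
    also have "\<dots> \<le> (1/4) ^ n"
    proof -
      have "finite (F - Q n)" "F - Q n \<subseteq> S" "(F - Q n) \<inter> Q n = {}" using F by auto
      then show ?thesis using Q[of n] unfolding good_def by simp
    qed
    finally show ?thesis .
  qed
  have lL: "lincomb F c e \<in> L2" if "F \<subseteq> S" for F
    using that besselD_L2[OF be] by (intro lincomb_L2) auto
  have QS: "finite (Q n)" "Q n \<subseteq> S" for n using Q[of n] by (auto simp: good_def)
  obtain y where y: "y \<in> L2" "\<And>n. (L2_norm (\<lambda>t. y t - lincomb (Q n) c e t))\<^sup>2 \<le> (1/4) ^ n"
    using L2_complete[of "\<lambda>n. lincomb (Q n) c e", OF lL[OF QS(2)] lin[OF QS Qmono]] by blast
  have sq: "r \<le> (1/2) ^ n" if "r\<^sup>2 \<le> (1/4) ^ n" for r :: real and n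
  proof (rule power2_le_imp_le)
    show "r\<^sup>2 \<le> ((1/2) ^ n)\<^sup>2" using that by (simp add: power2_eq_square flip: power_mult_distrib)
  qed simp
  have "L2_sum_on S c e y"
    unfolding L2_sum_on_def
  proof (rule order_tendstoI)
    fix \<epsilon> :: real assume "0 < \<epsilon>"
    then obtain n where n: "(1/2) ^ n < \<epsilon> / 2" using real_arch_pow_inv[of "\<epsilon> / 2" "1/2"] by auto
    show "\<forall>\<^sub>F F in finite_subsets_at_top S. L2_norm (\<lambda>t. y t - lincomb F c e t) < \<epsilon>"
      unfolding eventually_finite_subsets_at_top
    proof (intro exI conjI allI impI)
      fix F assume F: "finite F \<and> Q n \<subseteq> F \<and> F \<subseteq> S"
      have "L2_norm (\<lambda>t. y t - lincomb F c e t) \<le> L2_norm (\<lambda>t. y t - lincomb (Q n) c e t)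
          + L2_norm (\<lambda>t. lincomb (Q n) c e t - lincomb F c e t)"
        using y(1) lL F by (intro L2_norm_triangle_mid) auto
      also have "\<dots> \<le> (1/2) ^ n + (1/2) ^ n"
      proof (intro add_mono sq)
        show "(L2_norm (\<lambda>t. y t - lincomb (Q n) c e t))\<^sup>2 \<le> (1/4) ^ n" by (rule y(2))
        show "(L2_norm (\<lambda>t. lincomb (Q n) c e t - lincomb F c e t))\<^sup>2 \<le> (1/4) ^ n"
          by (subst L2_norm_minus_commute) (use F in \<open>intro lin; simp\<close>)
      qed
      finally show "L2_norm (\<lambda>t. y t - lincomb F c e t) < \<epsilon>" using n by simp
    qed (use QS in auto)
  next
    fix \<epsilon> :: real assume "\<epsilon> < 0"
    then show "\<forall>\<^sub>F F in finite_subsets_at_top S. \<epsilon> < L2_norm (\<lambda>t. y t - lincomb F c e t)"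
      by (intro always_eventually allI) (rule order_less_le_trans, auto)
  qed
  with y(1) show ?thesis by (rule that)
qed

section \<open>Orthonormal families and closed subspaces\<close>

lemma bessel_summable:
  assumes "bessel B S e" "x \<in> L2" shows "(\<lambda>s. (cmod (L2_inner x (e s)))\<^sup>2) summable_on S"
proof (rule nonneg_bdd_above_summable_on)
  show "bdd_above (sum (\<lambda>s. (cmod (L2_inner x (e s)))\<^sup>2) ` {F. F \<subseteq> S \<and> finite F})"
  proof (rule bdd_aboveI2)
    fix F assume "F \<in> {F. F \<subseteq> S \<and> finite F}"
    then show "(\<Sum>s\<in>F. (cmod (L2_inner x (e s)))\<^sup>2) \<le> B * (L2_norm x)\<^sup>2"
      using assms unfolding bessel_def by blast
  qed
qed simp

definition orthonormal_on :: "'i set \<Rightarrow> ('i \<Rightarrow> real \<Rightarrow> complex) \<Rightarrow> bool" where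
  "orthonormal_on S e \<longleftrightarrow> e ` S \<subseteq> L2 \<and>
     (\<forall>s\<in>S. \<forall>t\<in>S. L2_inner (e s) (e t) = (if s = t then 1 else 0))"

text \<open>The conclusion is \<open>L2_norm x = 0\<close> rather than \<open>x = 0\<close> because
  functions stand for classes modulo null sets.\<close>

definition total_in :: "(real \<Rightarrow> complex) set \<Rightarrow> 'i set \<Rightarrow> ('i \<Rightarrow> real \<Rightarrow> complex) \<Rightarrow> bool" where
  "total_in M S e \<longleftrightarrow> (\<forall>x\<in>M. (\<forall>s\<in>S. L2_inner x (e s) = 0) \<longrightarrow> L2_norm x = 0)"

text \<open>The approximation clause expresses closedness; at distance zero it also makes
  \<open>M\<close> stable, within \<open>L2\<close>, under changes on null sets.\<close>

definition closed_subspace :: "(real \<Rightarrow> complex) set \<Rightarrow> bool" where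
  "closed_subspace M \<longleftrightarrow> M \<subseteq> L2 \<and> (\<lambda>t. 0) \<in> M \<and>
     (\<forall>x\<in>M. \<forall>y\<in>M. \<forall>c. (\<lambda>t. x t + c * y t) \<in> M) \<and>
     (\<forall>y\<in>L2. (\<forall>\<epsilon>>0. \<exists>z\<in>M. L2_norm (\<lambda>t. y t - z t) < \<epsilon>) \<longrightarrow> y \<in> M)"

definition orthogonal_complement :: "(real \<Rightarrow> complex) set \<Rightarrow> (real \<Rightarrow> complex) set" where
  "orthogonal_complement Y = {x \<in> L2. \<forall>y\<in>Y. L2_inner x y = 0}"

definition closed_span :: "('i \<Rightarrow> real \<Rightarrow> complex) \<Rightarrow> (real \<Rightarrow> complex) set" where
  "closed_span e = {y \<in> L2. \<forall>\<epsilon>>0. \<exists>F c. finite F \<and> L2_norm (\<lambda>t. y t - lincomb F c e t) < \<epsilon>}"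

lemma orthonormal_on_L2: "orthonormal_on S e \<Longrightarrow> s \<in> S \<Longrightarrow> e s \<in> L2"
  by (auto simp: orthonormal_on_def)

lemma orthonormal_on_inner:
  "orthonormal_on S e \<Longrightarrow> s \<in> S \<Longrightarrow> t \<in> S \<Longrightarrow> L2_inner (e s) (e t) = (if s = t then 1 else 0)"
  by (simp add: orthonormal_on_def)

lemma orthonormal_on_norm:
  assumes "orthonormal_on S e" "s \<in> S" shows "L2_norm (e s) = 1"
proof -
  have "complex_of_real ((L2_norm (e s))\<^sup>2) = 1"
    unfolding L2_inner_self[symmetric] orthonormal_on_inner[OF assms assms(2)] by simp
  then have "(L2_norm (e s))\<^sup>2 = 1" by (simp only: of_real_eq_1_iff)
  then show ?thesis using L2_norm_nonneg[of "e s"] by (auto simp: power2_eq_1_iff)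
qed

lemma orthonormal_on_norm_lincomb:
  assumes "orthonormal_on S e" "finite F" "F \<subseteq> S"
  shows "(L2_norm (lincomb F c e))\<^sup>2 = (\<Sum>s\<in>F. (cmod (c s))\<^sup>2)"
proof -
  have eL: "\<And>s. s \<in> F \<Longrightarrow> e s \<in> L2" using assms(3) by (intro orthonormal_on_L2[OF assms(1)]) blast
  have coeff: "L2_inner (e s) (lincomb F c e) = cnj (c s)" if s: "s \<in> F" for s
  proof -
    have "L2_inner (e s) (lincomb F c e) = (\<Sum>t\<in>F. cnj (c t) * L2_inner (e s) (e t))"
      using eL eL[OF s] by (rule L2_inner_lincomb_right)
    also have "\<dots> = (\<Sum>t\<in>F. if s = t then cnj (c t) else 0)"
    proof (rule sum.cong[OF refl])
      fix t assume "t \<in> F"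
      then have "s \<in> S" "t \<in> S" using s assms(3) by auto
      then show "cnj (c t) * L2_inner (e s) (e t) = (if s = t then cnj (c t) else 0)"
        using orthonormal_on_inner[OF assms(1), of s t] by auto
    qed
    finally show ?thesis using s assms(2) by simp
  qed
  have "complex_of_real ((L2_norm (lincomb F c e))\<^sup>2) = (\<Sum>s\<in>F. c s * L2_inner (e s) (lincomb F c e))"
    unfolding L2_inner_self[symmetric] by (rule L2_inner_lincomb_left[OF eL lincomb_L2[OF eL]])
  also have "\<dots> = (\<Sum>s\<in>F. complex_of_real ((cmod (c s))\<^sup>2))"
    by (rule sum.cong[OF refl]) (simp only: coeff complex_norm_square)
  finally show ?thesis by (simp only: of_real_sum[symmetric] of_real_eq_iff)
qed

lemma orthonormal_on_bessel: "orthonormal_on S e \<Longrightarrow> bessel 1 S e"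
  by (rule besselI) (auto simp: orthonormal_on_L2 orthonormal_on_norm_lincomb)

lemma L2_sum_on_coefficient:
  assumes on: "orthonormal_on S e" and sm: "L2_sum_on S c e y" "y \<in> L2" and s: "s \<in> S"
  shows "L2_inner y (e s) = c s"
proof -
  have "((\<lambda>s'. c s' * L2_inner (e s') (e s)) has_sum L2_inner y (e s)) S"
    using sm orthonormal_on_L2[OF on] s by (intro L2_sum_on_inner) auto
  moreover have "((\<lambda>s'. c s' * L2_inner (e s') (e s)) has_sum c s) S"
    by (rule has_sum_finite_neutralI[of "{s}"])
       (use s in \<open>auto simp: orthonormal_on_inner[OF on]\<close>)
  ultimately show ?thesis by (rule has_sum_unique)
qed

section \<open>Closed subspaces and orthogonal projection\<close>

lemma closed_subspace_L2: "closed_subspace M \<Longrightarrow> x \<in> M \<Longrightarrow> x \<in> L2"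
  by (auto simp: closed_subspace_def)

lemma closed_subspace_add: "closed_subspace M \<Longrightarrow> x \<in> M \<Longrightarrow> y \<in> M \<Longrightarrow> (\<lambda>t. x t + c * y t) \<in> M"
  by (simp add: closed_subspace_def)

lemma closed_subspace_diff: "closed_subspace M \<Longrightarrow> x \<in> M \<Longrightarrow> y \<in> M \<Longrightarrow> (\<lambda>t. x t - y t) \<in> M"
  using closed_subspace_add[of M x y "-1"] by simp

lemma closed_subspace_scale: "closed_subspace M \<Longrightarrow> x \<in> M \<Longrightarrow> (\<lambda>t. c * x t) \<in> M"
  using closed_subspace_add[of M "\<lambda>t. 0" x c] by (simp add: closed_subspace_def)

lemma closed_subspace_lincomb:
  assumes "closed_subspace M" "\<And>s. s \<in> F \<Longrightarrow> e s \<in> M"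
  shows "lincomb F c e \<in> M"
  using assms(2)
proof (induction F rule: infinite_finite_induct)
  case (insert s F)
  then have "lincomb (insert s F) c e = (\<lambda>t. lincomb F c e t + c s * e s t)"
    by (auto simp: lincomb_def)
  then show ?case using insert closed_subspace_add[OF assms(1)] by simp
qed (use assms(1) in \<open>auto simp: lincomb_def[abs_def] closed_subspace_def\<close>)

lemma closed_subspace_sum_on:
  assumes "closed_subspace M" "\<And>s. s \<in> S \<Longrightarrow> e s \<in> M" "y \<in> L2" "L2_sum_on S c e y"
  shows "y \<in> M"
proof -
  have eL: "e s \<in> L2" if "s \<in> S" for s
    using closed_subspace_L2[OF assms(1) assms(2)[OF that]] .
  have "\<exists>z\<in>M. L2_norm (\<lambda>t. y t - z t) < \<epsilon>" if \<epsilon>: "\<epsilon> > 0" for \<epsilon>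
  proof -
    obtain F where F: "F \<subseteq> S" "L2_norm (\<lambda>t. y t - lincomb F c e t) < \<epsilon>"
      using L2_sum_on_norm[OF assms(4) eL assms(3) \<epsilon>] by auto
    moreover have "lincomb F c e \<in> M"
      using F(1) by (intro closed_subspace_lincomb[OF assms(1)] assms(2)) auto
    ultimately show ?thesis by blast
  qed
  then show ?thesis using assms(1,3) by (simp add: closed_subspace_def)
qed

lemma closed_subspace_UNIV: "closed_subspace L2"
  by (auto simp: closed_subspace_def)

lemma closed_subspace_orthogonal_complement:
  assumes Y: "Y \<subseteq> L2" shows "closed_subspace (orthogonal_complement Y)"
  unfolding closed_subspace_def
proof (intro conjI ballI impI allI)
  fix x y c assume "x \<in> orthogonal_complement Y" "y \<in> orthogonal_complement Y"
  then show "(\<lambda>t. x t + c * y t) \<in> orthogonal_complement Y"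
    using Y unfolding orthogonal_complement_def
    by (auto simp: L2_inner_add_left L2_inner_scale_left subset_iff)
next
  fix y assume y: "y \<in> L2" and *: "\<forall>\<epsilon>>0. \<exists>z\<in>orthogonal_complement Y. L2_norm (\<lambda>t. y t - z t) < \<epsilon>"
  have "L2_inner y v = 0" if v: "v \<in> Y" for v
  proof (rule ccontr)
    assume nz: "L2_inner y v \<noteq> 0"
    have vL: "v \<in> L2" using v Y by blast
    have "L2_norm v \<noteq> 0" using L2_Cauchy_Schwarz[OF y vL] nz by auto
    then have pos: "0 < L2_norm v" using L2_norm_nonneg[of v] by linarith
    then obtain z where z: "z \<in> orthogonal_complement Y"
        "L2_norm (\<lambda>t. y t - z t) < cmod (L2_inner y v) / L2_norm v"
      using * nz by (meson divide_pos_pos zero_less_norm_iff)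
    have zL: "z \<in> L2" and "L2_inner z v = 0" using z(1) v by (auto simp: orthogonal_complement_def)
    then have "cmod (L2_inner y v) \<le> L2_norm (\<lambda>t. y t - z t) * L2_norm v"
      using L2_Cauchy_Schwarz[OF L2_diff[OF y zL] vL] L2_inner_diff_left[OF y zL vL] by simp
    then show False using z(2) pos by (simp add: pos_less_divide_eq)
  qed
  then show "y \<in> orthogonal_complement Y" using y by (simp add: orthogonal_complement_def)
qed (auto simp: orthogonal_complement_def)

lemma lincomb_add_scale:
  assumes "finite F" "finite G"
  shows "lincomb F c e t + k * lincomb G d e t
    = lincomb (F \<union> G) (\<lambda>s. (if s \<in> F then c s else 0) + k * (if s \<in> G then d s else 0)) e t"
proof -
  have "lincomb F c e t = (\<Sum>s\<in>F \<union> G. (if s \<in> F then c s else 0) * e s t)"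
    unfolding lincomb_def using assms by (intro sum.mono_neutral_cong_left) auto
  moreover have "lincomb G d e t = (\<Sum>s\<in>F \<union> G. (if s \<in> G then d s else 0) * e s t)"
    unfolding lincomb_def using assms by (intro sum.mono_neutral_cong_left) auto
  ultimately show ?thesis
    by (simp add: lincomb_def sum.distrib sum_distrib_left distrib_right mult.assoc)
qed

lemma closed_subspace_closed_span:
  assumes eL: "\<And>s. e s \<in> L2" shows "closed_subspace (closed_span e)"
  unfolding closed_subspace_def
proof (intro conjI ballI impI allI)
  have "\<exists>F c. finite F \<and> L2_norm (\<lambda>t. 0 - lincomb F c e t) < \<epsilon>" if "\<epsilon> > 0" for \<epsilon>
    by (rule exI[of _ "{}"]) (use that in \<open>simp add: lincomb_def L2_norm_def\<close>)
  then show "(\<lambda>t. 0) \<in> closed_span e" by (simp add: closed_span_def)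
next
  fix x y k assume x: "x \<in> closed_span e" and y: "y \<in> closed_span e"
  have xL: "x \<in> L2" and yL: "y \<in> L2" using x y by (auto simp: closed_span_def)
  have "\<exists>F c. finite F \<and> L2_norm (\<lambda>t. x t + k * y t - lincomb F c e t) < \<epsilon>" if \<epsilon>: "\<epsilon> > 0" for \<epsilon>
  proof -
    obtain F c where F: "finite F" "L2_norm (\<lambda>t. x t - lincomb F c e t) < \<epsilon> / 2"
      using x \<epsilon> unfolding closed_span_def by (auto dest!: spec[of _ "\<epsilon> / 2"])
    \<comment> \<open>Adding \<open>1\<close> keeps the denominator positive when
      \<open>k = 0\<close>.\<close>
    have p: "0 < \<epsilon> / (2 * (cmod k + 1))"
      using \<epsilon> by (intro divide_pos_pos mult_pos_pos add_nonneg_pos) auto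
    obtain G d where G: "finite G" "L2_norm (\<lambda>t. y t - lincomb G d e t) < \<epsilon> / (2 * (cmod k + 1))"
      using y p unfolding closed_span_def by blast
    have "L2_norm (\<lambda>t. (x t - lincomb F c e t) - (-k) * (y t - lincomb G d e t))
        \<le> L2_norm (\<lambda>t. x t - lincomb F c e t) + L2_norm (\<lambda>t. (-k) * (y t - lincomb G d e t))"
      using xL yL eL by (intro L2_norm_triangle_diff L2_scale L2_diff lincomb_L2) auto
    also have "\<dots> < \<epsilon> / 2 + \<epsilon> / 2"
    proof (rule add_less_le_mono[OF F(2)])
      have "L2_norm (\<lambda>t. (-k) * (y t - lincomb G d e t)) = cmod k * L2_norm (\<lambda>t. y t - lincomb G d e t)"
        by (subst L2_norm_scale) simp
      also have "\<dots> \<le> (cmod k + 1) * (\<epsilon> / (2 * (cmod k + 1)))"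
        using G(2) by (intro mult_mono) auto
      also have "\<dots> = \<epsilon> / 2"
        by (simp add: add_nonneg_eq_0_iff field_simps)
      finally show "L2_norm (\<lambda>t. (-k) * (y t - lincomb G d e t)) \<le> \<epsilon> / 2" .
    qed
    also have "(\<lambda>t. (x t - lincomb F c e t) - (-k) * (y t - lincomb G d e t))
        = (\<lambda>t. x t + k * y t - (lincomb F c e t + k * lincomb G d e t))"
      by (simp add: algebra_simps)
    finally show ?thesis using F(1) G(1) unfolding lincomb_add_scale[OF F(1) G(1)]
      by (intro exI[of _ "F \<union> G"] exI) auto
  qed
  then show "(\<lambda>t. x t + k * y t) \<in> closed_span e" using xL yL by (simp add: closed_span_def)
next
  fix y assume yL: "y \<in> L2" and y: "\<forall>\<epsilon>>0. \<exists>z\<in>closed_span e. L2_norm (\<lambda>t. y t - z t) < \<epsilon>"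
  have "\<exists>F c. finite F \<and> L2_norm (\<lambda>t. y t - lincomb F c e t) < \<epsilon>" if \<epsilon>: "\<epsilon> > 0" for \<epsilon>
  proof -
    obtain z where z: "z \<in> closed_span e" "L2_norm (\<lambda>t. y t - z t) < \<epsilon> / 2"
      using y \<epsilon> half_gt_zero by blast
    then obtain F c where F: "finite F" "L2_norm (\<lambda>t. z t - lincomb F c e t) < \<epsilon> / 2"
      using \<epsilon> half_gt_zero unfolding closed_span_def by blast
    have "L2_norm (\<lambda>t. y t - lincomb F c e t) \<le> L2_norm (\<lambda>t. y t - z t) + L2_norm (\<lambda>t. z t - lincomb F c e t)"
      using yL z(1) eL by (intro L2_norm_triangle_mid) (auto simp: closed_span_def)
    then show ?thesis using z(2) F by (intro exI[of _ F] exI[of _ c]) auto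
  qed
  then show "y \<in> closed_span e" using yL by (simp add: closed_span_def)
qed (auto simp: closed_span_def)

lemma in_closed_span:
  assumes "e i \<in> L2" shows "e i \<in> closed_span e"
proof -
  have "\<exists>F c. finite F \<and> L2_norm (\<lambda>t. e i t - lincomb F c e t) < \<epsilon>" if "\<epsilon> > 0" for \<epsilon>
    by (rule exI[of _ "{i}"], rule exI[of _ "\<lambda>_. 1"])
       (use that in \<open>simp add: lincomb_def L2_norm_def\<close>)
  then show ?thesis using assms by (simp add: closed_span_def)
qed

text \<open>The Fourier series converges to some \<open>y\<close>, and \<open>x - y\<close> is
  orthogonal to the family, hence null. As \<open>x\<close> and \<open>y\<close> may still differ as
  functions, the convergence is transferred by the triangle inequality.\<close>

lemma orthonormal_total_expansion:
  assumes M: "closed_subspace M" and on: "orthonormal_on S e" and eM: "\<And>s. s \<in> S \<Longrightarrow> e s \<in> M"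
    and tot: "total_in M S e" and x: "x \<in> M"
  shows "L2_sum_on S (\<lambda>s. L2_inner x (e s)) e x"
proof -
  have xL: "x \<in> L2" using closed_subspace_L2[OF M x] .
  have be: "bessel 1 S e" by (rule orthonormal_on_bessel[OF on])
  obtain y where y: "y \<in> L2" "L2_sum_on S (\<lambda>s. L2_inner x (e s)) e y"
    by (rule L2_Riesz_Fischer[OF be bessel_summable[OF be xL]])
  have "y \<in> M" using closed_subspace_sum_on[OF M eM y] .
  then have "(\<lambda>t. x t - y t) \<in> M" by (rule closed_subspace_diff[OF M x])
  moreover have "L2_inner (\<lambda>t. x t - y t) (e s) = 0" if "s \<in> S" for s
    using L2_sum_on_coefficient[OF on y(2,1) that] xL y(1) orthonormal_on_L2[OF on that]
    by (simp add: L2_inner_diff_left)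
  ultimately have 0: "L2_norm (\<lambda>t. x t - y t) = 0" using tot by (simp add: total_in_def)
  show ?thesis unfolding L2_sum_on_def
  proof (rule tendsto_sandwich[OF _ _ tendsto_const y(2)[unfolded L2_sum_on_def]])
    show "\<forall>\<^sub>F F in finite_subsets_at_top S. L2_norm (\<lambda>t. x t - lincomb F (\<lambda>s. L2_inner x (e s)) e t)
        \<le> L2_norm (\<lambda>t. y t - lincomb F (\<lambda>s. L2_inner x (e s)) e t)"
    proof (rule eventually_finite_subsets_at_top_weakI)
      fix F assume "F \<subseteq> S"
      then have "lincomb F (\<lambda>s. L2_inner x (e s)) e \<in> L2"
        using orthonormal_on_L2[OF on] by (intro lincomb_L2) auto
      from L2_norm_triangle_mid[OF xL y(1) this]
      show "L2_norm (\<lambda>t. x t - lincomb F (\<lambda>s. L2_inner x (e s)) e t)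
        \<le> L2_norm (\<lambda>t. y t - lincomb F (\<lambda>s. L2_inner x (e s)) e t)" using 0 by simp
    qed
  qed auto
qed

lemma orthonormal_basisI:
  assumes on: "orthonormal_on UNIV e" and tot: "total_in L2 UNIV e"
  shows "orthonormal_basis e"
  unfolding orthonormal_basis_def
proof (intro conjI ballI allI impI)
  show "range e \<subseteq> L2" using on by (auto simp: orthonormal_on_def)
  show "L2_inner (e i) (e j) = (if i = j then 1 else 0)" for i j
    using on by (simp add: orthonormal_on_def)
  fix x \<epsilon> assume x: "x \<in> L2" and \<epsilon>: "0 < (\<epsilon>::real)"
  have "L2_sum_on UNIV (\<lambda>s. L2_inner x (e s)) e x"
    using orthonormal_total_expansion[OF closed_subspace_UNIV on orthonormal_on_L2[OF on] tot x] .
  from L2_sum_on_norm[OF this orthonormal_on_L2[OF on] x \<epsilon>]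
  obtain F where "finite F" "L2_norm (\<lambda>t. x t - lincomb F (\<lambda>s. L2_inner x (e s)) e t) < \<epsilon>"
    by auto
  then show "\<exists>F c. finite F \<and> L2_norm (\<lambda>t. x t - (\<Sum>i\<in>F. c i * e i t)) < \<epsilon>"
    unfolding lincomb_def by (intro exI conjI)
qed

text \<open>Zorn's lemma on orthonormal sets indexed by themselves. Distinct functions representing
  the same element never share such a set, since their inner product would be \<open>1\<close>
  instead of \<open>0\<close>. A non-null vector orthogonal to a maximal set could be normalised and
  added.\<close>

lemma closed_subspace_orthonormal_total:
  assumes M: "closed_subspace M"
  obtains S where "S \<subseteq> M" "orthonormal_on S (\<lambda>s. s)" "total_in M S (\<lambda>s. s)"
proof -
  define A where "A = {S. S \<subseteq> M \<and> orthonormal_on S (\<lambda>s. s)}"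
  have "\<exists>S\<in>A. \<forall>X\<in>A. S \<subseteq> X \<longrightarrow> X = S"
  proof (rule subset_Zorn')
    fix C assume C: "subset.chain A C"
    have CA: "X \<subseteq> M" "orthonormal_on X (\<lambda>s. s)" if "X \<in> C" for X
      using C that by (auto simp: subset_chain_def A_def)
    have "L2_inner s t = (if s = t then 1 else 0)" if st: "s \<in> \<Union>C" "t \<in> \<Union>C" for s t
    proof -
      from st obtain X where X: "X \<in> C" "s \<in> X" "t \<in> X"
        using C unfolding subset_chain_def by blast
      show ?thesis using orthonormal_on_inner[OF CA(2)[OF X(1)] X(2,3)] .
    qed
    moreover have "\<Union>C \<subseteq> M" using CA(1) by (rule Union_least)
    moreover have "\<Union>C \<subseteq> L2" using \<open>\<Union>C \<subseteq> M\<close> M unfolding closed_subspace_def by (blast intro: order_trans)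
    ultimately show "\<Union>C \<in> A" unfolding A_def orthonormal_on_def by (simp add: image_ident)
  qed
  then obtain S where S: "S \<in> A" and max: "\<And>X. X \<in> A \<Longrightarrow> S \<subseteq> X \<Longrightarrow> X = S" by blast
  have on: "orthonormal_on S (\<lambda>s. s)" and SM: "S \<subseteq> M" using S by (auto simp: A_def)
  have "total_in M S (\<lambda>s. s)"
    unfolding total_in_def
  proof (intro ballI impI, rule ccontr)
    fix x assume x: "x \<in> M" "\<forall>s\<in>S. L2_inner x s = 0" "L2_norm x \<noteq> 0"
    define z where "z = (\<lambda>t. of_real (1 / L2_norm x) * x t)"
    have zM: "z \<in> M" unfolding z_def using closed_subspace_scale[OF M x(1)] .
    have zs: "L2_inner z s = 0" if "s \<in> S" for s
      using x(2) that unfolding z_def L2_inner_scale_left by simp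
    then have sz: "L2_inner s z = 0" if "s \<in> S" for s
      using that L2_inner_cnj[of z s] by simp
    have "L2_norm z = 1" using x(3) unfolding z_def L2_norm_scale by (simp add: norm_divide)
    then have zz: "L2_inner z z = 1" by (simp add: L2_inner_self)
    have zS: "z \<notin> S" using zs zz by force
    have "orthonormal_on (insert z S) (\<lambda>s. s)"
      unfolding orthonormal_on_def
    proof (intro conjI ballI)
      show "(\<lambda>s. s) ` insert z S \<subseteq> L2"
        using on closed_subspace_L2[OF M zM] by (simp add: orthonormal_on_def)
      fix s t assume "s \<in> insert z S" "t \<in> insert z S"
      then show "L2_inner s t = (if s = t then 1 else 0)"
        using zz zs[of t] sz[of s] orthonormal_on_inner[OF on, of s t] zS by auto
    qed
    then have "insert z S \<in> A" using SM zM by (simp add: A_def)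
    then have "insert z S = S" by (rule max) blast
    then show False using zS by blast
  qed
  with SM on show ?thesis by (rule that)
qed

text \<open>The Fourier series of \<open>x\<close> over an orthonormal total set of \<open>M\<close>
  leaves a remainder orthogonal to that set; expanding \<open>z\<close> over the same set extends
  the orthogonality to all of \<open>M\<close>.\<close>

lemma orthogonal_projection:
  assumes M: "closed_subspace M" and x: "x \<in> L2"
  obtains y where "y \<in> M" "\<And>z. z \<in> M \<Longrightarrow> L2_inner (\<lambda>t. x t - y t) z = 0"
proof -
  obtain S where S: "S \<subseteq> M" "orthonormal_on S (\<lambda>s. s)" "total_in M S (\<lambda>s. s)"
    using closed_subspace_orthonormal_total[OF M] by blast
  have SL: "\<And>s. s \<in> S \<Longrightarrow> s \<in> L2" using S(1) closed_subspace_L2[OF M] by blast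
  have be: "bessel 1 S (\<lambda>s. s)" by (rule orthonormal_on_bessel[OF S(2)])
  obtain y where y: "y \<in> L2" "L2_sum_on S (\<lambda>s. L2_inner x s) (\<lambda>s. s) y"
    by (rule L2_Riesz_Fischer[OF be bessel_summable[OF be x]])
  show ?thesis
  proof
    show "y \<in> M" by (rule closed_subspace_sum_on[OF M _ y]) (use S(1) in blast)
    fix z assume z: "z \<in> M"
    have zL: "z \<in> L2" using closed_subspace_L2[OF M z] .
    have D: "(\<lambda>t. x t - y t) \<in> L2" using x y(1) by simp
    have "L2_inner s (\<lambda>t. x t - y t) = 0" if "s \<in> S" for s
    proof -
      have "L2_inner (\<lambda>t. x t - y t) s = 0"
        using L2_sum_on_coefficient[OF S(2) y(2,1) that] x y(1) SL[OF that]
        by (simp add: L2_inner_diff_left)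
      then show ?thesis using L2_inner_cnj[of "\<lambda>t. x t - y t" s] by simp
    qed
    then have "((\<lambda>s. L2_inner z s * L2_inner s (\<lambda>t. x t - y t)) has_sum 0) S"
      by (intro has_sum_0) simp
    moreover have "L2_sum_on S (\<lambda>s. L2_inner z s) (\<lambda>s. s) z"
      by (rule orthonormal_total_expansion[OF M S(2) _ S(3) z]) (use S(1) in blast)
    from L2_sum_on_inner[OF this SL zL D]
    have "((\<lambda>s. L2_inner z s * L2_inner s (\<lambda>t. x t - y t)) has_sum L2_inner z (\<lambda>t. x t - y t)) S" .
    ultimately have "L2_inner z (\<lambda>t. x t - y t) = 0" by (rule has_sum_unique[symmetric])
    then show "L2_inner (\<lambda>t. x t - y t) z = 0" using L2_inner_cnj[of z "\<lambda>t. x t - y t"] by simp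
  qed
qed

section \<open>Parseval frames and separability\<close>

lemma parseval_frame_has_sum:
  assumes "parseval_frame u" "x \<in> L2"
  shows "((\<lambda>i. (cmod (L2_inner x (u i)))\<^sup>2) has_sum (L2_norm x)\<^sup>2) UNIV"
proof -
  have "(\<lambda>i. (cmod (L2_inner x (u i)))\<^sup>2) summable_on UNIV"
    "(\<Sum>\<^sub>\<infinity>i. (cmod (L2_inner x (u i)))\<^sup>2) = (L2_norm x)\<^sup>2"
    using assms unfolding parseval_frame_def frame_with_bounds_def by (auto intro: antisym)
  then show ?thesis by (metis has_sum_infsum)
qed

lemma frame_with_bounds_bessel:
  assumes "frame_with_bounds A B g" "0 \<le> B" shows "bessel B UNIV g"
  unfolding bessel_def
proof (intro conjI ballI allI impI)
  fix x and F :: "'a set" assume x: "x \<in> L2" and F: "finite F"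
  have "(\<Sum>i\<in>F. (cmod (L2_inner x (g i)))\<^sup>2) \<le> (\<Sum>\<^sub>\<infinity>i. (cmod (L2_inner x (g i)))\<^sup>2)"
    using assms x F unfolding frame_with_bounds_def by (intro finite_sum_le_infsum) auto
  also have "\<dots> \<le> B * (L2_norm x)\<^sup>2" using assms x unfolding frame_with_bounds_def by blast
  finally show "(\<Sum>i\<in>F. (cmod (L2_inner x (g i)))\<^sup>2) \<le> B * (L2_norm x)\<^sup>2" .
qed (use assms in \<open>auto simp: frame_with_bounds_def\<close>)

lemma parseval_frame_L2: "parseval_frame u \<Longrightarrow> u i \<in> L2"
  by (auto simp: parseval_frame_def frame_with_bounds_def)

lemma parseval_frame_expansion:
  assumes "parseval_frame u" "x \<in> L2"
  shows "L2_sum_on UNIV (\<lambda>i. L2_inner x (u i)) u x"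
proof (rule L2_sum_on_expansion[OF _ assms(2) parseval_frame_has_sum[OF assms]])
  show "bessel 1 UNIV u" using assms(1) unfolding parseval_frame_def by (rule frame_with_bounds_bessel) simp
qed

lemma parseval_frame_inner:
  assumes "parseval_frame u" "x \<in> L2" "y \<in> L2"
  shows "((\<lambda>i. L2_inner x (u i) * L2_inner (u i) y) has_sum L2_inner x y) UNIV"
  using L2_sum_on_inner[OF parseval_frame_expansion[OF assms(1,2)] parseval_frame_L2[OF assms(1)] assms(2,3)] .

text \<open>Separability enters through the countable index type of the frame: by Bessel's
  inequality each \<open>u i\<close> has non-zero inner product with only countably many
  \<open>e s\<close>, and no unit vector is orthogonal to all \<open>u i\<close>.\<close>

lemma orthonormal_on_countable:
  fixes u :: "'i::countable \<Rightarrow> real \<Rightarrow> complex"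
  assumes u: "parseval_frame u" and on: "orthonormal_on S e"
  shows "countable S"
proof -
  have "countable {s \<in> S. (cmod (L2_inner (u i) (e s)))\<^sup>2 \<noteq> 0}" for i
  proof (rule summable_countable_real)
    have "bessel 1 S e" by (rule orthonormal_on_bessel[OF on])
    then show "(\<lambda>s. (cmod (L2_inner (u i) (e s)))\<^sup>2) summable_on S"
      using parseval_frame_L2[OF u] by (rule bessel_summable)
  qed
  then have "countable (\<Union>i. {s \<in> S. (cmod (L2_inner (u i) (e s)))\<^sup>2 \<noteq> 0})" by simp
  moreover have "S \<subseteq> (\<Union>i. {s \<in> S. (cmod (L2_inner (u i) (e s)))\<^sup>2 \<noteq> 0})"
  proof
    fix s assume s: "s \<in> S"
    show "s \<in> (\<Union>i. {s \<in> S. (cmod (L2_inner (u i) (e s)))\<^sup>2 \<noteq> 0})"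
    proof (rule ccontr)
      assume "\<not> ?thesis"
      then have "L2_inner (e s) (u i) = 0" for i
        using s L2_inner_norm_commute[of "u i" "e s"] by auto
      then have "((\<lambda>i. (cmod (L2_inner (e s) (u i)))\<^sup>2) has_sum 0) UNIV"
        by (intro has_sum_0) simp
      from has_sum_unique[OF this parseval_frame_has_sum[OF u orthonormal_on_L2[OF on s]]]
      have "(L2_norm (e s))\<^sup>2 = 0" by simp
      then show False using orthonormal_on_norm[OF on s] by simp
    qed
  qed
  ultimately show ?thesis by (rule countable_subset[rotated])
qed

text \<open>Subtracting from \<open>u\<^sub>k\<close> its frame expansion gives a null combination of the \<open>u\<^sub>j\<close>, whose coefficients
  \<open>\<delta>\<^bsub>jk\<^esub> - \<langle>u\<^sub>k, u\<^sub>j\<rangle>\<close> vanish by the lower Riesz bound.\<close>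

lemma parseval_frame_lower_riesz_orthonormal:
  assumes u: "parseval_frame u" and K: "0 < K"
    and lower: "\<And>F c. finite F \<Longrightarrow> K * (\<Sum>j\<in>F. (cmod (c j))\<^sup>2) \<le> (L2_norm (lincomb F c u))\<^sup>2"
  shows "orthonormal_on UNIV u" "total_in L2 UNIV u"
proof -
  have "L2_inner (u k) (u j) = (if k = j then 1 else 0)" for k j
  proof -
    define c where "c i = (if i = k then 1 else 0) - L2_inner (u k) (u i)" for i
    have "K * (cmod (c j))\<^sup>2 \<le> \<epsilon>\<^sup>2" if \<epsilon>: "\<epsilon> > 0" for \<epsilon>
    proof -
      have "\<forall>\<^sub>F F in finite_subsets_at_top UNIV. L2_norm (\<lambda>t. u k t - lincomb F (\<lambda>i. L2_inner (u
          k) (u i)) u t) < \<epsilon>"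
        using parseval_frame_expansion[OF u parseval_frame_L2[OF u, of k]] \<epsilon> unfolding L2_sum_on_def
        by (rule order_tendstoD)
      then obtain F0 where F0: "finite F0" and
        le: "\<And>F. finite F \<Longrightarrow> F0 \<subseteq> F \<Longrightarrow> L2_norm (\<lambda>t. u k t - lincomb F (\<lambda>i. L2_inner (u k) (u i)) u t) < \<epsilon>"
        unfolding eventually_finite_subsets_at_top by auto
      \<comment> \<open>Including \<open>k\<close> makes the Kronecker part of \<open>c\<close>
        produce \<open>u k\<close>; including \<open>j\<close> brings \<open>c j\<close> into the
        sum that the lower bound controls.\<close>
      define F where "F = F0 \<union> {k, j}"
      have F: "finite F" "F0 \<subseteq> F" "k \<in> F" "j \<in> F" using F0 by (auto simp: F_def)
      have "lincomb F c u = (\<lambda>t. u k t - lincomb F (\<lambda>i. L2_inner (u k) (u i)) u t)"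
      proof
        fix t
        have "(\<Sum>i\<in>F. (if i = k then 1 else 0) * u i t) = (\<Sum>i\<in>F. if i = k then u i t else 0)"
          by (rule sum.cong) auto
        also have "\<dots> = u k t" using F by simp
        finally show "lincomb F c u t = u k t - lincomb F (\<lambda>i. L2_inner (u k) (u i)) u t"
          by (simp add: lincomb_def c_def left_diff_distrib sum_subtractf)
      qed
      then have "(L2_norm (lincomb F c u))\<^sup>2 \<le> \<epsilon>\<^sup>2"
        using less_imp_le[OF le[OF F(1,2)]] L2_norm_nonneg by (simp add: power_mono)
      moreover have "K * (cmod (c j))\<^sup>2 \<le> K * (\<Sum>j\<in>F. (cmod (c j))\<^sup>2)"
        using K F by (intro mult_left_mono member_le_sum) auto
      ultimately show ?thesis using lower[OF F(1), of c] by linarith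
    qed
    \<comment> \<open>Inserting a square root turns the bound by a square into a bound by an
      arbitrary positive number.\<close>
    from this[of "sqrt _"] have "K * (cmod (c j))\<^sup>2 \<le> 0 + \<epsilon>" if "\<epsilon> > 0" for \<epsilon>
      using that by simp
    then have "K * (cmod (c j))\<^sup>2 \<le> 0" by (rule field_le_epsilon)
    then have "c j = 0" using K by (simp add: mult_le_0_iff)
    then show ?thesis by (auto simp: c_def split: if_splits)
  qed
  then show "orthonormal_on UNIV u" using parseval_frame_L2[OF u] by (auto simp: orthonormal_on_def)
  show "total_in L2 UNIV u"
    unfolding total_in_def
  proof (intro ballI impI)
    fix x assume x: "x \<in> L2" "\<forall>s\<in>UNIV. L2_inner x (u s) = 0"
    then have "((\<lambda>i. (cmod (L2_inner x (u i)))\<^sup>2) has_sum 0) UNIV"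
      by (intro has_sum_0) simp
    from has_sum_unique[OF this parseval_frame_has_sum[OF u x(1)]] show "L2_norm x = 0" by simp
  qed
qed

section \<open>Exponentials on an interval\<close>

definition wave :: "real \<Rightarrow> real \<Rightarrow> complex" where
  "wave x t = cis (2 * pi * x * t)"

lemma modulation_wave: "modulation x g t = wave x t * g t"
  by (simp add: modulation_def wave_def cis_conv_exp algebra_simps)

lemma wave_measurable [measurable]: "wave x \<in> borel_measurable borel"
  unfolding wave_def[abs_def] by (intro borel_measurable_continuous_onI continuous_intros)

lemma norm_wave [simp]: "cmod (wave x t) = 1"
  by (simp add: wave_def)

lemma wave_add: "wave x (t + s) = wave x t * wave x s"
  by (simp add: wave_def cis_mult algebra_simps)

lemma wave_mult_cnj: "wave x t * cnj (wave y t) = wave (x - y) t"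
  by (simp add: wave_def cis_mult cis_cnj algebra_simps)

lemma wave_Ints: "x * t \<in> \<int> \<Longrightarrow> wave x t = 1"
  using cis_multiple_2pi[of "x * t"] by (simp add: wave_def mult.assoc)

lemma wave_period: "x * s \<in> \<int> \<Longrightarrow> wave x (t + s) = wave x t"
  by (simp add: wave_add wave_Ints)

lemma integral_translation:
  fixes g :: "real \<Rightarrow> 'a::{banach, second_countable_topology}"
  shows "(\<integral>t. g (t + c) \<partial>lborel) = (\<integral>t. g t \<partial>lborel)"
  using lborel_integral_real_affine[of 1 g c] by (simp add: add.commute)

lemma integrable_translation:
  fixes g :: "real \<Rightarrow> 'a::{banach, second_countable_topology}"
  shows "integrable lborel g \<Longrightarrow> integrable lborel (\<lambda>t. g (t + c))"
  using lborel_integrable_real_affine[of g 1 c] by (simp add: add.commute)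

lemma L2_translation:
  assumes "x \<in> L2" shows "(\<lambda>t. x (t + c)) \<in> L2"
proof -
  note [measurable] = L2_measurable[OF assms]
  show ?thesis
    using integrable_translation[OF L2_integrable_square[OF assms], of c] by (simp add: L2_def)
qed

lemma L2_inner_translation: "L2_inner (\<lambda>t. x (t + c)) (\<lambda>t. y (t + c)) = L2_inner x y"
  unfolding L2_inner_def by (rule integral_translation)

lemma L2_norm_translation: "L2_norm (\<lambda>t. x (t + c)) = L2_norm x"
  unfolding L2_norm_def by (subst integral_translation) (rule refl)

lemma L2_interval_wave: "(\<lambda>t. indicator {\<alpha>..<\<beta>} t * wave x t) \<in> L2"
proof (rule L2_I_bound)
  show "(\<lambda>t. indicator {\<alpha>..<\<beta>} t * wave x t) \<in> borel_measurable lborel" by measurable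
  show "integrable lborel (indicator {\<alpha>..<\<beta>} :: real \<Rightarrow> real)"
    by (cases "\<alpha> \<le> \<beta>") (auto intro!: integrable_real_indicator)
qed (auto simp: indicator_def)

text \<open>The antiderivative \<open>cis (\<omega> * t) / (\<i> * of_real \<omega>)\<close> has
  period \<open>p\<close>, so the boundary terms cancel.\<close>

lemma integral_wave_period:
  assumes p: "p > 0" and k: "k \<noteq> 0"
  shows "(\<integral>t. indicator {\<alpha>..<\<alpha> + p} t * wave (of_int k / p) t \<partial>lborel) = 0"
proof -
  define \<omega> where "\<omega> = 2 * pi * (of_int k / p)"
  have \<omega>: "\<omega> \<noteq> 0" using p k by (simp add: \<omega>_def)
  have w: "wave (of_int k / p) t = cis (\<omega> * t)" for t by (simp add: wave_def \<omega>_def)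
  have deriv: "((\<lambda>t. cis (\<omega> * t) / (\<i> * of_real \<omega>)) has_vector_derivative cis (\<omega> * t)) (at t within X)" for t X
  proof -
    have "((\<lambda>z. exp (\<i> * of_real \<omega> * z) / (\<i> * of_real \<omega>)) has_field_derivative
        exp (\<i> * of_real \<omega> * of_real t)) (at (of_real t))"
      using \<omega> by (auto intro!: derivative_eq_intros)
    from has_vector_derivative_real_field[OF this, of X] show ?thesis
      by (simp add: cis_conv_exp mult.assoc)
  qed
  have "(\<integral>t. indicator {\<alpha>..<\<alpha> + p} t * wave (of_int k / p) t \<partial>lborel)
      = (\<integral>t. indicator {\<alpha>..\<alpha> + p} t *\<^sub>R cis (\<omega> * t) \<partial>lborel)"
  proof (rule integral_cong_AE)
    show "AE t in lborel. indicator {\<alpha>..<\<alpha> + p} t * wave (of_int k / p) t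
        = indicator {\<alpha>..\<alpha> + p} t *\<^sub>R cis (\<omega> * t)"
      using AE_lborel_singleton[of "\<alpha> + p"]
      by eventually_elim (auto simp: indicator_def w)
    have "(\<lambda>t. cis (\<omega> * t)) \<in> borel_measurable borel"
      by (intro borel_measurable_continuous_onI continuous_intros)
    then show "(\<lambda>t. indicator {\<alpha>..\<alpha> + p} t *\<^sub>R cis (\<omega> * t)) \<in> borel_measurable lborel" by measurable
  qed measurable
  also have "\<dots> = cis (\<omega> * (\<alpha> + p)) / (\<i> * of_real \<omega>) - cis (\<omega> * \<alpha>) / (\<i> * of_real \<omega>)"
    using p by (intro integral_FTC_atLeastAtMost deriv continuous_intros) auto
  also have "cis (\<omega> * (\<alpha> + p)) = cis (\<omega> * \<alpha>)"
    unfolding w[symmetric] using p by (intro wave_period) auto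
  finally show ?thesis by simp
qed

lemma orthonormal_waves:
  assumes p: "p > 0"
  shows "orthonormal_on UNIV (\<lambda>m::int. \<lambda>t. of_real (1 / sqrt p) * (indicator {\<alpha>..<\<alpha> + p} t * wave
      (of_int m / p) t))"
  unfolding orthonormal_on_def
proof (intro conjI ballI)
  show "range (\<lambda>m::int. \<lambda>t. of_real (1 / sqrt p) * (indicator {\<alpha>..<\<alpha> + p} t * wave (of_int m / p) t)) \<subseteq> L2"
    by (intro image_subsetI L2_scale L2_interval_wave)
  fix m n :: int
  have "L2_inner (\<lambda>t. of_real (1 / sqrt p) * (indicator {\<alpha>..<\<alpha> + p} t * wave (of_int m / p) t))
      (\<lambda>t. of_real (1 / sqrt p) * (indicator {\<alpha>..<\<alpha> + p} t * wave (of_int n / p) t))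
    = (\<integral>t. of_real (1 / p) * (indicator {\<alpha>..<\<alpha> + p} t * wave (of_int (m - n) / p) t) \<partial>lborel)"
    unfolding L2_inner_def
  proof (rule Bochner_Integration.integral_cong[OF refl])
    fix t
    have "of_real (1 / sqrt p) * of_real (1 / sqrt p) = (of_real (1 / p) :: complex)"
      using p by (simp flip: of_real_mult)
    then show "of_real (1 / sqrt p) * (indicator {\<alpha>..<\<alpha> + p} t * wave (of_int m / p) t) *
        cnj (of_real (1 / sqrt p) * (indicator {\<alpha>..<\<alpha> + p} t * wave (of_int n / p) t))
      = of_real (1 / p) * (indicator {\<alpha>..<\<alpha> + p} t * wave (of_int (m - n) / p) t)"
      using wave_mult_cnj[of "of_int m / p" t "of_int n / p"]
      by (auto simp: indicator_def diff_divide_distrib)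
  qed
  also have "\<dots> = of_real (1 / p) * (\<integral>t. indicator {\<alpha>..<\<alpha> + p} t * wave (of_int (m - n) / p) t \<partial>lborel)"
    by (rule integral_mult_right_zero)
  also have "\<dots> = (if m = n then 1 else 0)"
  proof (cases "m = n")
    case True
    have "(\<integral>t. indicator {\<alpha>..<\<alpha> + p} t * wave (of_int (m - n) / p) t \<partial>lborel)
        = (\<integral>t. complex_of_real (indicator {\<alpha>..<\<alpha> + p} t) \<partial>lborel)"
      using True by (intro Bochner_Integration.integral_cong) (auto simp: indicator_def wave_def)
    also have "\<dots> = of_real p"
      unfolding integral_complex_of_real using p by simp
    finally show ?thesis using p True by simp
  next
    case False
    then show ?thesis using integral_wave_period[OF p, of "m - n" \<alpha>] by simp
  qed
  finally show "L2_inner (\<lambda>t. of_real (1 / sqrt p) * (indicator {\<alpha>..<\<alpha> + p} t * wave (of_int m / p) t))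
      (\<lambda>t. of_real (1 / sqrt p) * (indicator {\<alpha>..<\<alpha> + p} t * wave (of_int n / p) t))
    = (if m = n then 1 else 0)" .
qed

text \<open>Bessel's inequality on the full period \<open>{\<alpha>..<\<alpha> + p}\<close>, applied
  to \<open>\<phi>\<close> cut off to the possibly shorter interval. The factor \<open>p\<close>
  undoes the normalisation \<open>1 / sqrt p\<close> of the exponentials.\<close>

lemma fourier_bessel_interval:
  assumes p: "p > 0" and \<beta>: "\<beta> \<le> \<alpha> + p" and \<phi>: "\<phi> \<in> L2" and M: "finite M"
  shows "(\<Sum>m\<in>M. (cmod (\<integral>t. indicator {\<alpha>..<\<beta>} t * \<phi> t * cnj (wave (of_int m / p) t) \<partial>lborel))\<^sup>2)
    \<le> p * (\<integral>t. indicator {\<alpha>..<\<beta>} t * (cmod (\<phi> t))\<^sup>2 \<partial>lborel)"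
proof -
  define e where "e m t = of_real (1 / sqrt p) * (indicator {\<alpha>..<\<alpha> + p} t * wave (of_int m / p) t)" for m t
  define x where "x t = indicator {\<alpha>..<\<beta>} t * \<phi> t" for t
  have on: "orthonormal_on UNIV e"
    using orthonormal_waves[OF p, of \<alpha>] by (simp add: e_def[abs_def])
  have x: "x \<in> L2" unfolding x_def using \<phi> by (intro L2_restrict) auto
  have inner: "L2_inner x (e m) = of_real (1 / sqrt p) * (\<integral>t. indicator {\<alpha>..<\<beta>} t * \<phi> t * cnj
      (wave (of_int m / p) t) \<partial>lborel)" for m
    unfolding L2_inner_def integral_mult_right_zero[symmetric]
    by (rule Bochner_Integration.integral_cong) (use \<beta> in \<open>auto simp: x_def e_def indicator_def\<close>)
  have "(cmod (\<integral>t. indicator {\<alpha>..<\<beta>} t * \<phi> t * cnj (wave (of_int m / p) t) \<partial>lborel))\<^sup>2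
      = p * (cmod (L2_inner x (e m)))\<^sup>2" for m
    unfolding inner norm_mult power_mult_distrib using p by (simp add: norm_divide power_divide)
  then have "(\<Sum>m\<in>M. (cmod (\<integral>t. indicator {\<alpha>..<\<beta>} t * \<phi> t * cnj (wave (of_int m / p) t) \<partial>lborel))\<^sup>2)
      = p * (\<Sum>m\<in>M. (cmod (L2_inner x (e m)))\<^sup>2)"
    by (simp add: sum_distrib_left)
  also have "\<dots> \<le> p * (1 * (L2_norm x)\<^sup>2)"
    using orthonormal_on_bessel[OF on] x M p unfolding bessel_def by (intro mult_left_mono) auto
  also have "(L2_norm x)\<^sup>2 = (\<integral>t. indicator {\<alpha>..<\<beta>} t * (cmod (\<phi> t))\<^sup>2 \<partial>lborel)"
    unfolding L2_norm_square
    by (rule Bochner_Integration.integral_cong) (auto simp: x_def indicator_def)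
  finally show ?thesis by simp
qed

lemma integral_norm_square_trig_poly:
  assumes p: "p > 0" and M: "finite (M :: int set)"
  shows "(\<integral>t. indicator {0..<p} t * (cmod (\<Sum>m\<in>M. c m * wave (of_int m / p) t))\<^sup>2 \<partial>lborel)
    = p * (\<Sum>m\<in>M. (cmod (c m))\<^sup>2)"
proof -
  define e where "e m t = of_real (1 / sqrt p) * (indicator {0..<0 + p} t * wave (of_int m / p)
      t)" for m :: int and t
  have on: "orthonormal_on UNIV e"
    using orthonormal_waves[OF p, of 0] by (simp only: e_def[abs_def])
  have "(\<integral>t. indicator {0..<p} t * (cmod (\<Sum>m\<in>M. c m * wave (of_int m / p) t))\<^sup>2 \<partial>lborel)
      = (\<integral>t. p * (cmod (lincomb M c e t))\<^sup>2 \<partial>lborel)"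
  proof (rule Bochner_Integration.integral_cong[OF refl])
    fix t
    have "lincomb M c e t = of_real (1 / sqrt p) * (indicator {0..<p} t * (\<Sum>m\<in>M. c m * wave (of_int m / p) t))"
      by (simp add: lincomb_def e_def sum_distrib_left mult_ac)
    then show "indicator {0..<p} t * (cmod (\<Sum>m\<in>M. c m * wave (of_int m / p) t))\<^sup>2
        = p * (cmod (lincomb M c e t))\<^sup>2"
      using p by (simp add: norm_mult norm_divide power_mult_distrib power_divide indicator_def)
  qed
  also have "\<dots> = p * (L2_norm (lincomb M c e))\<^sup>2"
    by (simp add: L2_norm_square)
  finally show ?thesis using orthonormal_on_norm_lincomb[OF on M] by simp
qed

section \<open>The duality principle for Gabor systems\<close>

lemma gabor_system_wave:
  "gabor_system a b f (m, n) t = wave (of_int m * b) t * f (t - of_int n * a)"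
  by (simp add: gabor_system_def modulation_wave translation_def)

lemma adjoint_system_wave:
  "adjoint_system a b f (m, n) t = of_real (1 / sqrt (a * b)) * (wave (of_int m / a) t * f (t - of_int n / b))"
  by (simp add: adjoint_system_def modulation_wave translation_def)

lemma L2_gabor_system: assumes "f \<in> L2" shows "gabor_system a b f i \<in> L2"
proof (cases i)
  case (Pair m n)
  have "(\<lambda>t. wave (of_int m * b) t * f (t + (- (of_int n * a)))) \<in> L2"
    by (rule L2_bounded_mult[OF L2_translation[OF assms], where C = 1]) auto
  then show ?thesis unfolding Pair gabor_system_wave[abs_def] by simp
qed

lemma adjoint_system_gabor:
  assumes "a > 0" "b > 0"
  shows "adjoint_system a b f i t = of_real (1 / sqrt (a * b)) * gabor_system (1 / b) (1 / a) f i t"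
  by (cases i) (simp add: adjoint_system_wave gabor_system_wave)

lemma L2_adjoint_system: assumes "f \<in> L2" "a > 0" "b > 0" shows "adjoint_system a b f i \<in> L2"
  using L2_scale[OF L2_gabor_system[OF assms(1), of "1/b" "1/a" i], of "of_real (1 / sqrt (a * b))"]
  unfolding adjoint_system_gabor[OF assms(2,3), abs_def] .

text \<open>Passing to the adjoint lattice twice leads back to the original one. Through this
  identity, duality for the lattice \<open>(1/b, 1/a)\<close> becomes a statement about the original
  Gabor system.\<close>

lemma adjoint_system_swap:
  assumes "a > 0" "b > 0"
  shows "adjoint_system (1 / b) (1 / a) f i t = of_real (sqrt (a * b)) * gabor_system a b f i t"
  using assms by (cases i) (simp add: adjoint_system_wave gabor_system_wave real_sqrt_divide)

text \<open>The test function carries \<open>cnj (C l)\<close> on the translate by \<open>-l/b\<close> of a short interval \<open>J\<close>. The shifts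
  by multiples of \<open>1/b\<close> are invisible to the modulations \<open>e\<^bsup>2\<pi>imbt\<^esup>\<close>, so its Gabor coefficients are
  Fourier coefficients on \<open>J\<close> of the translates of \<open>G\<close>.\<close>

lemma gabor_test_function:
  fixes C :: "int \<Rightarrow> real \<Rightarrow> complex" and L :: "int set"
  assumes a: "a > 0" and b: "b > 0" and f: "f \<in> L2" and L: "finite L"
    and C [measurable]: "\<And>l. C l \<in> borel_measurable borel" and Cb: "\<And>l t. cmod (C l t) \<le> D l"
    and Cper: "\<And>l n t. C l (t - of_int n * a) = C l t"
    and J: "\<beta> \<le> \<alpha> + 1 / b"
  defines "h \<equiv> \<lambda>s. \<Sum>l\<in>L. indicator {\<alpha>..<\<beta>} (s + of_int l / b) * cnj (C l (s + of_int l / b))"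
    and "G \<equiv> \<lambda>t. \<Sum>l\<in>L. C l t * f (t - of_int l / b)"
  shows "h \<in> L2"
    and "(L2_norm h)\<^sup>2 = (\<Sum>l\<in>L. \<integral>t. indicator {\<alpha>..<\<beta>} t * (cmod (C l t))\<^sup>2 \<partial>lborel)"
    and "L2_inner h (gabor_system a b f (m, n))
      = (\<integral>t. indicator {\<alpha>..<\<beta>} t * cnj (G (t - of_int n * a)) * cnj (wave (of_int m / (1 / b)) t) \<partial>lborel)"
proof -
  have CL: "(\<lambda>t. indicator {\<alpha>..<\<beta>} t * cnj (C l t)) \<in> L2" for l
  proof (rule L2_I_bound)
    show "(\<lambda>t. indicator {\<alpha>..<\<beta>} t * cnj (C l t)) \<in> borel_measurable lborel" by measurable
    show "integrable lborel (\<lambda>t. (D l)\<^sup>2 * (cmod (indicator {\<alpha>..<\<beta>} t * wave 0 t))\<^sup>2)"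
      by (intro integrable_mult_right L2_integrable_square L2_interval_wave)
    show "(cmod (indicator {\<alpha>..<\<beta>} t * cnj (C l t)))\<^sup>2
        \<le> (D l)\<^sup>2 * (cmod (indicator {\<alpha>..<\<beta>} t * wave 0 t))\<^sup>2" for t
      using Cb[of l t] by (auto simp: indicator_def intro!: power_mono)
  qed
  then have hL: "(\<lambda>s. indicator {\<alpha>..<\<beta>} (s + of_int l / b) * cnj (C l (s + of_int l / b))) \<in> L2" for l
    by (rule L2_translation)
  then show "h \<in> L2" unfolding h_def by (intro L2_sum)
  \<comment> \<open>Different multiples of \<open>1/b\<close> are at least \<open>1/b\<close> apart,
    more than two points of a half-open interval of length at most \<open>1/b\<close> can be. So at
    most one summand of \<open>h\<close> is non-zero at any point, and the square of
    \<open>h\<close> has no cross terms.\<close>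
  have disj: "l = l'" if "s + of_int l / b \<in> {\<alpha>..<\<beta>}" "s + of_int l' / b \<in> {\<alpha>..<\<beta>}" for s l l'
  proof -
    have "\<bar>real_of_int l / b - real_of_int l' / b\<bar> < 1 / b" using that J by auto
    then have "\<bar>real_of_int (l - l')\<bar> / b < 1 / b" using b by (simp add: abs_divide flip: diff_divide_distrib)
    then have "\<bar>real_of_int (l - l')\<bar> < 1" using b by (simp add: divide_less_cancel)
    then show ?thesis by linarith
  qed
  have sq: "(cmod (h s))\<^sup>2 = (\<Sum>l\<in>L. indicator {\<alpha>..<\<beta>} (s + of_int l / b) * (cmod (C l (s + of_int
      l / b)))\<^sup>2)" for s
  proof (cases "\<exists>l\<in>L. s + of_int l / b \<in> {\<alpha>..<\<beta>}")
    case True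
    then obtain l where l: "l \<in> L" "s + of_int l / b \<in> {\<alpha>..<\<beta>}" by blast
    have z: "indicator {\<alpha>..<\<beta>} (s + of_int l' / b) = (0 :: real)"
        "indicator {\<alpha>..<\<beta>} (s + of_int l' / b) = (0 :: complex)" if "l' \<in> L - {l}" for l'
      using disj[OF l(2), of l'] that by (auto simp: indicator_def simp del: atLeastLessThan_iff)
    have "h s = cnj (C l (s + of_int l / b))"
      unfolding h_def by (subst sum.remove[OF L l(1)]) (use l z in simp)
    moreover have "(\<Sum>l\<in>L. indicator {\<alpha>..<\<beta>} (s + of_int l / b) * (cmod (C l (s + of_int l / b)))\<^sup>2)
        = (cmod (C l (s + of_int l / b)))\<^sup>2"
      by (subst sum.remove[OF L l(1)]) (use l z in simp)
    ultimately show ?thesis by simp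
  next
    case False
    then have z: "indicator {\<alpha>..<\<beta>} (s + of_int l / b) = (0 :: real)"
        "indicator {\<alpha>..<\<beta>} (s + of_int l / b) = (0 :: complex)" if "l \<in> L" for l
      using that by (auto simp: indicator_def simp del: atLeastLessThan_iff)
    then show ?thesis by (simp add: h_def)
  qed
  have int: "integrable lborel (\<lambda>t. indicator {\<alpha>..<\<beta>} t * (cmod (C l t))\<^sup>2)" for l
  proof -
    have "(\<lambda>t. indicator {\<alpha>..<\<beta>} t * (cmod (C l t))\<^sup>2) = (\<lambda>t. (cmod (indicator {\<alpha>..<\<beta>} t * cnj (C l t)))\<^sup>2)"
      by (auto simp: indicator_def fun_eq_iff)
    then show ?thesis using L2_integrable_square[OF CL, of l] by simp
  qed
  show "(L2_norm h)\<^sup>2 = (\<Sum>l\<in>L. \<integral>t. indicator {\<alpha>..<\<beta>} t * (cmod (C l t))\<^sup>2 \<partial>lborel)"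
    unfolding L2_norm_square sq
    by (subst Bochner_Integration.integral_sum)
       (auto intro!: integrable_translation[OF int] sum.cong
         integral_translation[of "\<lambda>t. indicator {\<alpha>..<\<beta>} t * (cmod (C _ t))\<^sup>2"])
  have w: "wave (of_int m * b) (t - of_int l / b) = wave (of_int m * b) t" for t l
    using wave_period[of "of_int m * b" "- (of_int l / b)" t] b by simp
  \<comment> \<open>The \<open>l\<close>-th integrand after the substitution that brings every
    summand to the same interval; by \<open>w\<close> the modulation does not notice the
    shift.\<close>
  define k where "k l t = indicator {\<alpha>..<\<beta>} t * cnj (C l t) * cnj (wave (of_int m * b) t * f (t -
      of_int l / b - of_int n * a))" for l t
  have k: "k l (s + of_int l / b) = indicator {\<alpha>..<\<beta>} (s + of_int l / b) * cnj (C l (s + of_int l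
      / b)) * cnj (gabor_system a b f (m, n) s)" for l s
    using w[of "s + of_int l / b" l] by (simp add: k_def gabor_system_wave)
  have kint: "integrable lborel (\<lambda>s. k l (s + of_int l / b))" for l
    unfolding k by (rule L2_inner_integrable[OF hL L2_gabor_system[OF f]])
  then have kint': "integrable lborel (k l)" for l
    using integrable_translation[OF kint[of l], of "- (of_int l / b)"] by simp
  have "L2_inner h (gabor_system a b f (m, n)) = (\<Sum>l\<in>L. \<integral>s. k l (s + of_int l / b) \<partial>lborel)"
    unfolding L2_inner_def h_def sum_distrib_right k[symmetric]
    by (rule Bochner_Integration.integral_sum) (rule kint)
  also have "\<dots> = (\<Sum>l\<in>L. \<integral>s. k l s \<partial>lborel)"
    by (simp only: integral_translation)
  also have "\<dots> = (\<integral>s. (\<Sum>l\<in>L. k l s) \<partial>lborel)"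
    by (rule Bochner_Integration.integral_sum[symmetric]) (rule kint')
  also have "\<dots> = (\<integral>t. indicator {\<alpha>..<\<beta>} t * cnj (G (t - of_int n * a)) * cnj (wave (of_int m / (1
      / b)) t) \<partial>lborel)"
  proof (rule Bochner_Integration.integral_cong[OF refl])
    fix t
    \<comment> \<open>Periodicity replaces \<open>C l t\<close> by its value at
      \<open>t - n a\<close>, so that the sum over \<open>l\<close> becomes \<open>G\<close> at that
      point.\<close>
    have "k l t = indicator {\<alpha>..<\<beta>} t * cnj (C l (t - of_int n * a) * f (t - of_int n * a - of_int l / b))
        * cnj (wave (of_int m / (1 / b)) t)" for l
      unfolding Cper k_def by (simp add: cancel_ab_semigroup_add_class.diff_right_commute[of t "of_int l / b"])
    then show "(\<Sum>l\<in>L. k l t)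
        = indicator {\<alpha>..<\<beta>} t * cnj (G (t - of_int n * a)) * cnj (wave (of_int m / (1 / b)) t)"
      by (simp only: G_def cnj_sum sum_distrib_left sum_distrib_right)
  qed
  finally show "L2_inner h (gabor_system a b f (m, n))
      = (\<integral>t. indicator {\<alpha>..<\<beta>} t * cnj (G (t - of_int n * a)) * cnj (wave (of_int m / (1 / b)) t) \<partial>lborel)" .
qed


text \<open>Grouped by translation index, the coefficients become trigonometric polynomials
  \<open>C l\<close> of period \<open>a\<close>, and the combination is a multiple of
  \<open>G\<close>. The frame bound at the test function for a short interval \<open>J k\<close>
  compares the square integrals of the \<open>C l\<close> over \<open>J k\<close> with that of
  \<open>G\<close> over all translates of \<open>J k\<close> by multiples of \<open>a\<close>.
  Summed over the pieces of one period, the left side gives the coefficients and the right side at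
  most the norm of \<open>G\<close>.\<close>

lemma gabor_duality:
  assumes a: "a > 0" and b: "b > 0" and f: "f \<in> L2" and A: "0 \<le> A"
    and summ: "\<And>h. h \<in> L2 \<Longrightarrow> (\<lambda>i. (cmod (L2_inner h (gabor_system a b f i)))\<^sup>2) summable_on UNIV"
    and lower: "\<And>h. h \<in> L2 \<Longrightarrow> A * (L2_norm h)\<^sup>2 \<le> (\<Sum>\<^sub>\<infinity>i. (cmod (L2_inner h (gabor_system a b f i)))\<^sup>2)"
    and F: "finite F"
  shows "A * (\<Sum>i\<in>F. (cmod (c i))\<^sup>2) \<le> (L2_norm (lincomb F c (adjoint_system a b f)))\<^sup>2"
proof -
  define M where "M = fst ` F"
  define L where "L = snd ` F"
  have fin: "finite M" "finite L" and sub: "F \<subseteq> M \<times> L"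
    using F by (auto simp: M_def L_def image_iff) (metis fst_conv snd_conv)+
  \<comment> \<open>Padding \<open>F\<close> with zero coefficients to the rectangle
    \<open>M \<times> L\<close> separates the modulation index from the translation index.\<close>
  define d where "d i = (if i \<in> F then c i else 0)" for i
  define C where "C l t = (\<Sum>m\<in>M. d (m, l) * wave (of_int m / a) t)" for l t
  define G where "G t = (\<Sum>l\<in>L. C l t * f (t - of_int l / b))" for t
  have Cm [measurable]: "C l \<in> borel_measurable borel" for l unfolding C_def by measurable
  have Cb: "cmod (C l t) \<le> (\<Sum>m\<in>M. cmod (d (m, l)))" for l t
    unfolding C_def by (rule order_trans[OF norm_sum]) (simp add: norm_mult)
  have Cper: "C l (t - of_int n * a) = C l t" for l n t
    unfolding C_def
  proof (rule sum.cong[OF refl])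
    fix m show "d (m, l) * wave (of_int m / a) (t - of_int n * a) = d (m, l) * wave (of_int m / a) t"
      using wave_period[of "of_int m / a" "- (of_int n * a)" t] a by simp
  qed
  have GL: "G \<in> L2"
    unfolding G_def
  proof (rule L2_sum)
    fix l
    have "(\<lambda>t. C l t * f (t + (- (of_int l / b)))) \<in> L2"
      by (rule L2_bounded_mult[OF L2_translation[OF f] _ Cb]) measurable
    then show "(\<lambda>t. C l t * f (t - of_int l / b)) \<in> L2" by simp
  qed
  have lin: "lincomb F c (adjoint_system a b f) = (\<lambda>t. of_real (1 / sqrt (a * b)) * G t)"
  proof
    fix t
    have "lincomb F c (adjoint_system a b f) t = (\<Sum>i\<in>M \<times> L. d i * adjoint_system a b f i t)"
      unfolding lincomb_def d_def using fin sub by (intro sum.mono_neutral_cong_left) auto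
    also have "\<dots> = (\<Sum>l\<in>L. \<Sum>m\<in>M. d (m, l) * adjoint_system a b f (m, l) t)"
      by (subst sum.swap) (simp add: sum.cartesian_product case_prod_unfold)
    also have "\<dots> = of_real (1 / sqrt (a * b)) * G t"
      unfolding G_def C_def adjoint_system_wave sum_distrib_left sum_distrib_right
      by (intro sum.cong refl) (simp add: mult_ac)
    finally show "lincomb F c (adjoint_system a b f) t = of_real (1 / sqrt (a * b)) * G t" .
  qed
  \<comment> \<open>A test function needs an interval of length at most \<open>1/b\<close>, but the
    period \<open>a\<close> may be longer. More than \<open>a b\<close> equal pieces are short
    enough.\<close>
  obtain K :: nat where K: "a * b < real K" "K > 0"
    using reals_Archimedean2[of "a * b"] a b
    by (metis gr_zeroI less_asym mult_pos_pos of_nat_0)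
  define lo where "lo k = real k * a / real K" for k
  define J where "J k = {lo k..<lo (Suc k)}" for k
  have len: "lo (Suc k) \<le> lo k + 1 / b" for k
  proof -
    have "lo (Suc k) = lo k + a / real K" by (simp add: lo_def add_divide_distrib distrib_right)
    moreover have "a / real K \<le> 1 / b" using K a b by (simp add: field_simps)
    ultimately show ?thesis by simp
  qed
  have lo_mono: "lo i \<le> lo j" if "i \<le> j" for i j
    using that a by (auto simp: lo_def intro!: divide_right_mono mult_right_mono)
  have loK: "lo 0 = 0" "lo K = a" using K by (auto simp: lo_def)
  have J_disj: "i = j" if "t \<in> J i" "t \<in> J j" for i j t
  proof -
    have "\<not> i < j" if "t \<in> J i" "t \<in> J j" for i j
      using that lo_mono[of "Suc i" j] by (auto simp: J_def)
    then show ?thesis using that by (metis nat_neq_iff)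
  qed
  have J_sub: "J k \<subseteq> {0..<a}" if "k < K" for k
    using lo_mono[of 0 k] lo_mono[of "Suc k" K] loK that by (auto simp: J_def)
  have J_UN: "(\<Union>k<K. J k) = {0..<a}"
  proof
    have "{0..<lo k} \<subseteq> (\<Union>i<k. J i)" for k
    proof (induction k)
      case (Suc k)
      have "{0..<lo (Suc k)} \<subseteq> {0..<lo k} \<union> J k" by (auto simp: J_def)
      then show ?case using Suc.IH by (auto simp: lessThan_Suc)
    qed (simp add: loK)
    from this[of K] show "{0..<a} \<subseteq> (\<Union>k<K. J k)" by (simp add: loK)
  qed (use J_sub in auto)
  \<comment> \<open>This is \<open>J k\<close> moved by \<open>- n a\<close>. For all
    \<open>n\<close> and all \<open>k < K\<close> these sets are pairwise disjoint, because two
    points of \<open>{0..<a}\<close> differ by less than \<open>a\<close>.\<close>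
  define T where "T k n = {t. t + of_int n * a \<in> J k}" for k and n :: int
  define U where "U k = (\<Union>n. T k n)" for k
  have [measurable]: "J k \<in> sets borel" for k by (simp add: J_def)
  have [measurable]: "T k n \<in> sets borel" for k n
  proof -
    have "(\<lambda>t. t + real_of_int n * a) -` J k \<inter> space borel \<in> sets borel" by measurable
    then show ?thesis by (simp add: T_def vimage_def)
  qed
  have [measurable]: "U k \<in> sets borel" for k unfolding U_def by measurable
  have T_disj: "n = n' \<and> j = k" if "t \<in> T j n" "t \<in> T k n'" "j < K" "k < K" for t j k n n'
  proof -
    have "t + of_int n * a \<in> {0..<a}" "t + of_int n' * a \<in> {0..<a}"
      using subsetD[OF J_sub[OF that(3)]] subsetD[OF J_sub[OF that(4)]] that(1,2) by (simp_all add: T_def)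
    then have "\<bar>(real_of_int n - real_of_int n') * a\<bar> < 1 * a" by (auto simp: left_diff_distrib)
    then have "\<bar>real_of_int (n - n')\<bar> < 1" using a by (simp add: abs_mult)
    then have "n = n'" by linarith
    then show ?thesis using that J_disj by (auto simp: T_def)
  qed
  have Gint: "integrable lborel (\<lambda>t. indicator X t * (cmod (G t))\<^sup>2)" if [measurable]: "X \<in> sets borel" for X
  proof -
    have "(\<lambda>t. indicator X t * (cmod (G t))\<^sup>2) = (\<lambda>t. (cmod (indicator X t * G t))\<^sup>2)"
      by (auto simp: indicator_def fun_eq_iff)
    then show ?thesis using L2_integrable_square[OF L2_restrict[OF GL, of X]] that by simp
  qed
  have step: "A * (\<Sum>l\<in>L. \<integral>t. indicator (J k) t * (cmod (C l t))\<^sup>2 \<partial>lborel)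
      \<le> 1 / b * (\<integral>t. indicator (U k) t * (cmod (G t))\<^sup>2 \<partial>lborel)" if k: "k < K" for k
  proof -
    define h where "h = (\<lambda>s. \<Sum>l\<in>L. indicator (J k) (s + of_int l / b) * cnj (C l (s + of_int l / b)))"
    have test: "h \<in> L2"
      "(L2_norm h)\<^sup>2 = (\<Sum>l\<in>L. \<integral>t. indicator (J k) t * (cmod (C l t))\<^sup>2 \<partial>lborel)"
      "L2_inner h (gabor_system a b f (m, n))
        = (\<integral>t. indicator (J k) t * cnj (G (t - of_int n * a)) * cnj (wave (of_int m / (1 / b)) t)
            \<partial>lborel)" for m n
      unfolding h_def G_def J_def
      by (rule gabor_test_function[where C = C, OF a b f fin(2) Cm Cb Cper len])+
    have h: "h \<in> L2" using test(1) .
    \<comment> \<open>For fixed \<open>n\<close> the inner products are Fourier coefficients on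
      \<open>J k\<close> for the period \<open>1/b\<close>, which gives an integral over
      \<open>T k n\<close>; disjointness lets the bounds for different \<open>n\<close> add up
      within \<open>U k\<close>.\<close>
    have fs: "(\<Sum>i\<in>\<Phi>. (cmod (L2_inner h (gabor_system a b f i)))\<^sup>2)
        \<le> 1 / b * (\<integral>t. indicator (U k) t * (cmod (G t))\<^sup>2 \<partial>lborel)" if \<Phi>: "finite \<Phi>" for \<Phi>
    proof -
      define N where "N = snd ` \<Phi>"
      have N: "finite N" using \<Phi> by (simp add: N_def)
      have one: "(\<Sum>m\<in>fst ` \<Phi>. (cmod (L2_inner h (gabor_system a b f (m, n))))\<^sup>2)
          \<le> 1 / b * (\<integral>t. indicator (T k n) t * (cmod (G t))\<^sup>2 \<partial>lborel)" for n
      proof -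
        have "(\<lambda>t. cnj (G (t - of_int n * a))) \<in> L2"
          using L2_cnj[OF L2_translation[OF GL, of "- (of_int n * a)"]] by simp
        then have "(\<Sum>m\<in>fst ` \<Phi>. (cmod (L2_inner h (gabor_system a b f (m, n))))\<^sup>2)
            \<le> 1 / b * (\<integral>t. indicator (J k) t * (cmod (cnj (G (t - of_int n * a))))\<^sup>2 \<partial>lborel)"
          unfolding test(3) J_def using b \<Phi> len by (intro fourier_bessel_interval) auto
        also have "(\<integral>t. indicator (J k) t * (cmod (cnj (G (t - of_int n * a))))\<^sup>2 \<partial>lborel)
            = (\<integral>t. indicator (J k) (t + of_int n * a) * (cmod (cnj (G (t + of_int n * a - of_int n
                * a))))\<^sup>2 \<partial>lborel)"
          by (rule integral_translation[symmetric])
        also have "\<dots> = (\<integral>t. indicator (T k n) t * (cmod (G t))\<^sup>2 \<partial>lborel)"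
          by (rule Bochner_Integration.integral_cong) (auto simp: T_def indicator_def)
        finally show ?thesis .
      qed
      have "(\<Sum>i\<in>\<Phi>. (cmod (L2_inner h (gabor_system a b f i)))\<^sup>2)
          \<le> (\<Sum>i\<in>fst ` \<Phi> \<times> N. (cmod (L2_inner h (gabor_system a b f i)))\<^sup>2)"
        using \<Phi> by (intro sum_mono2) (auto simp: N_def image_iff, metis fst_conv, metis snd_conv)
      also have "\<dots> = (\<Sum>n\<in>N. \<Sum>m\<in>fst ` \<Phi>. (cmod (L2_inner h (gabor_system a b f (m, n))))\<^sup>2)"
        by (subst sum.swap) (simp add: sum.cartesian_product case_prod_unfold)
      also have "\<dots> \<le> (\<Sum>n\<in>N. 1 / b * (\<integral>t. indicator (T k n) t * (cmod (G t))\<^sup>2 \<partial>lborel))"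
        by (intro sum_mono one)
      also have "\<dots> = 1 / b * (\<integral>t. (\<Sum>n\<in>N. indicator (T k n) t * (cmod (G t))\<^sup>2) \<partial>lborel)"
        by (subst Bochner_Integration.integral_sum) (auto simp: sum_distrib_left intro: Gint)
      also have "\<dots> \<le> 1 / b * (\<integral>t. indicator (U k) t * (cmod (G t))\<^sup>2 \<partial>lborel)"
      proof (intro mult_left_mono integral_mono)
        show "integrable lborel (\<lambda>t. \<Sum>n\<in>N. indicator (T k n) t * (cmod (G t))\<^sup>2)"
          by (intro Bochner_Integration.integrable_sum Gint) measurable
        show "integrable lborel (\<lambda>t. indicator (U k) t * (cmod (G t))\<^sup>2)" by (intro Gint) measurable
        fix t
        have "(\<Sum>n\<in>N. indicator (T k n) t :: real) = indicator (\<Union>n\<in>N. T k n) t"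
          using T_disj k N by (intro indicator_UN_disjoint[symmetric]) (auto simp: disjoint_family_on_def)
        also have "\<dots> \<le> indicator (U k) t" by (auto simp: U_def indicator_def)
        finally show "(\<Sum>n\<in>N. indicator (T k n) t * (cmod (G t))\<^sup>2) \<le> indicator (U k) t * (cmod (G t))\<^sup>2"
          unfolding sum_distrib_right[symmetric] by (rule mult_right_mono) simp
      qed (use b in simp)
      finally show ?thesis .
    qed
    have "A * (L2_norm h)\<^sup>2 \<le> (\<Sum>\<^sub>\<infinity>i. (cmod (L2_inner h (gabor_system a b f i)))\<^sup>2)" by (rule lower[OF h])
    also have "\<dots> \<le> 1 / b * (\<integral>t. indicator (U k) t * (cmod (G t))\<^sup>2 \<partial>lborel)"
      by (rule infsum_le_finite_sums[OF summ[OF h] fs])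
    finally show ?thesis unfolding test(2) .
  qed
  have Cint: "integrable lborel (\<lambda>t. indicator X t * (cmod (C l t))\<^sup>2)"
    if [measurable]: "X \<in> sets borel" and X: "X \<subseteq> {0..<a}" for X l
  proof (rule Bochner_Integration.integrable_bound)
    show "integrable lborel (\<lambda>t. (\<Sum>m\<in>M. cmod (d (m, l)))\<^sup>2 * (cmod (indicator {0..<a} t * wave 0 t))\<^sup>2)"
      by (intro integrable_mult_right L2_integrable_square L2_interval_wave)
    show "AE t in lborel. norm (indicator X t * (cmod (C l t))\<^sup>2)
        \<le> norm ((\<Sum>m\<in>M. cmod (d (m, l)))\<^sup>2 * (cmod (indicator {0..<a} t * wave 0 t))\<^sup>2)"
      using X Cb[of l] by (intro AE_I2) (auto simp: indicator_def intro!: power_mono)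
  qed measurable
  have "A * (\<Sum>i\<in>F. (cmod (c i))\<^sup>2) = A * (\<Sum>i\<in>M \<times> L. (cmod (d i))\<^sup>2)"
    unfolding d_def using fin sub by (intro arg_cong2[where f = "(*)"] refl sum.mono_neutral_cong_left) auto
  also have "(\<Sum>i\<in>M \<times> L. (cmod (d i))\<^sup>2) = (\<Sum>l\<in>L. \<Sum>m\<in>M. (cmod (d (m, l)))\<^sup>2)"
    by (subst sum.swap) (simp add: sum.cartesian_product case_prod_unfold)
  \<comment> \<open>Parseval's identity: each inner sum is the mean square of \<open>C l\<close>
    over its period.\<close>
  also have "\<dots> = (\<Sum>l\<in>L. 1 / a * (\<integral>t. indicator {0..<a} t * (cmod (C l t))\<^sup>2 \<partial>lborel))"
    unfolding C_def using integral_norm_square_trig_poly[OF a fin(1)] a by simp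
  also have "\<dots> = (\<Sum>l\<in>L. 1 / a * (\<Sum>k<K. \<integral>t. indicator (J k) t * (cmod (C l t))\<^sup>2 \<partial>lborel))"
  proof (intro sum.cong refl arg_cong2[where f = "(*)"])
    fix l
    have ind: "(\<Sum>k<K. indicator (J k) t :: real) = indicator {0..<a} t" for t
      unfolding J_UN[symmetric] using J_disj by (intro indicator_UN_disjoint[symmetric]) (auto
          simp: disjoint_family_on_def)
    have "(\<Sum>k<K. \<integral>t. indicator (J k) t * (cmod (C l t))\<^sup>2 \<partial>lborel)
        = (\<integral>t. (\<Sum>k<K. indicator (J k) t) * (cmod (C l t))\<^sup>2 \<partial>lborel)"
      unfolding sum_distrib_right
      by (rule Bochner_Integration.integral_sum[symmetric]) (rule Cint[OF _ J_sub], simp_all add: J_def)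
    also have "\<dots> = (\<integral>t. indicator {0..<a} t * (cmod (C l t))\<^sup>2 \<partial>lborel)"
      by (simp only: ind)
    finally show "(\<integral>t. indicator {0..<a} t * (cmod (C l t))\<^sup>2 \<partial>lborel)
        = (\<Sum>k<K. \<integral>t. indicator (J k) t * (cmod (C l t))\<^sup>2 \<partial>lborel)" by simp
  qed
  also have "A * \<dots> = 1 / a * (\<Sum>k<K. A * (\<Sum>l\<in>L. \<integral>t. indicator (J k) t * (cmod (C l t))\<^sup>2 \<partial>lborel))"
    unfolding sum_distrib_left[symmetric] by (subst sum.swap) simp
  also have "\<dots> \<le> 1 / a * (\<Sum>k<K. 1 / b * (\<integral>t. indicator (U k) t * (cmod (G t))\<^sup>2 \<partial>lborel))"
    using a by (intro mult_left_mono sum_mono step) auto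
  also have "\<dots> = 1 / (a * b) * (\<integral>t. (\<Sum>k<K. indicator (U k) t * (cmod (G t))\<^sup>2) \<partial>lborel)"
    by (subst Bochner_Integration.integral_sum) (auto simp: sum_distrib_left intro: Gint)
  also have "\<dots> \<le> 1 / (a * b) * (\<integral>t. (cmod (G t))\<^sup>2 \<partial>lborel)"
  proof (intro mult_left_mono integral_mono)
    show "integrable lborel (\<lambda>t. \<Sum>k<K. indicator (U k) t * (cmod (G t))\<^sup>2)"
      by (intro Bochner_Integration.integrable_sum Gint) measurable
    show "integrable lborel (\<lambda>t. (cmod (G t))\<^sup>2)" by (rule L2_integrable_square[OF GL])
    fix t
    have "disjoint_family_on U {..<K}"
      unfolding disjoint_family_on_def U_def using T_disj by fastforce
    then have "(\<Sum>k<K. indicator (U k) t :: real) = indicator (\<Union>k<K. U k) t"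
      by (intro indicator_UN_disjoint[symmetric]) auto
    also have "\<dots> \<le> 1" by (simp add: indicator_def)
    finally show "(\<Sum>k<K. indicator (U k) t * (cmod (G t))\<^sup>2) \<le> (cmod (G t))\<^sup>2"
      unfolding sum_distrib_right[symmetric] using mult_right_mono[of _ 1 "(cmod (G t))\<^sup>2"] by simp
  qed (use a b in simp)
  also have "\<dots> = (L2_norm (lincomb F c (adjoint_system a b f)))\<^sup>2"
    unfolding lin L2_norm_scale power_mult_distrib L2_norm_square[of G] using a b
    by (simp add: norm_divide power_divide)
  finally show ?thesis .
qed

section \<open>Weak R-duals and Gram matrices\<close>

lemma orthonormal_total_norm:
  assumes M: "closed_subspace M" and on: "orthonormal_on S e" and eM: "\<And>s. s \<in> S \<Longrightarrow> e s \<in> M"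
    and tot: "total_in M S e" and x: "x \<in> M"
  shows "((\<lambda>s. (cmod (L2_inner x (e s)))\<^sup>2) has_sum (L2_norm x)\<^sup>2) S"
proof -
  have xL: "x \<in> L2" by (rule closed_subspace_L2[OF M x])
  have "((\<lambda>s. L2_inner x (e s) * L2_inner (e s) x) has_sum L2_inner x x) S"
    by (rule L2_sum_on_inner[OF orthonormal_total_expansion[OF M on eM tot x] orthonormal_on_L2[OF on] xL xL])
  moreover have "L2_inner x (e s) * L2_inner (e s) x = of_real ((cmod (L2_inner x (e s)))\<^sup>2)" for s
    using L2_inner_cnj[of x "e s"] by (simp only: complex_norm_square)
  ultimately have "((\<lambda>s. complex_of_real ((cmod (L2_inner x (e s)))\<^sup>2)) has_sum of_real ((L2_norm x)\<^sup>2)) S"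
    by (simp only: L2_inner_self)
  from has_sum_Re[OF this] show ?thesis by (simp del: of_real_power)
qed

text \<open>Double counting of the squared inner products between \<open>e\<close> and
  \<open>q\<close>: Parseval's identity for \<open>q\<close> gives \<open>card F\<close>, Bessel's
  inequality for \<open>e\<close> gives at most \<open>card Q\<close>.\<close>

lemma orthonormal_in_finite_dimensional:
  assumes M: "closed_subspace M" and on: "orthonormal_on S e" and eM: "\<And>s. s \<in> S \<Longrightarrow> e s \<in> M"
    and on': "orthonormal_on Q q" and qM: "\<And>s. s \<in> Q \<Longrightarrow> q s \<in> M" and tot: "total_in M Q q" and fin: "finite Q"
  shows "finite S"
proof (rule ccontr)
  assume "infinite S"
  then obtain F where F: "finite F" "F \<subseteq> S" "card F = Suc (card Q)"
    using infinite_arbitrarily_large by metis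
  have "real (card F) = (\<Sum>s\<in>F. \<Sum>t\<in>Q. (cmod (L2_inner (e s) (q t)))\<^sup>2)"
  proof -
    have "(\<Sum>t\<in>Q. (cmod (L2_inner (e s) (q t)))\<^sup>2) = 1" if "s \<in> F" for s
    proof -
      have s: "s \<in> S" using that F by blast
      have "((\<lambda>t. (cmod (L2_inner (e s) (q t)))\<^sup>2) has_sum (L2_norm (e s))\<^sup>2) Q"
        by (rule orthonormal_total_norm[OF M on' qM tot eM[OF s]])
      from has_sum_unique[OF this has_sum_finite[OF fin]]
      show ?thesis using orthonormal_on_norm[OF on s] by simp
    qed
    then show ?thesis by simp
  qed
  also have "\<dots> = (\<Sum>t\<in>Q. \<Sum>s\<in>F. (cmod (L2_inner (q t) (e s)))\<^sup>2)"
    by (subst sum.swap) (simp only: L2_inner_norm_commute)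
  also have "\<dots> \<le> (\<Sum>t\<in>Q. 1)"
  proof (rule sum_mono)
    fix t assume t: "t \<in> Q"
    have "bessel 1 S e" by (rule orthonormal_on_bessel[OF on])
    then have "(\<Sum>s\<in>F. (cmod (L2_inner (q t) (e s)))\<^sup>2) \<le> 1 * (L2_norm (q t))\<^sup>2"
      using orthonormal_on_L2[OF on' t] F unfolding bessel_def by blast
    then show "(\<Sum>s\<in>F. (cmod (L2_inner (q t) (e s)))\<^sup>2) \<le> 1"
      using orthonormal_on_norm[OF on' t] by simp
  qed
  finally show False using F(3) by simp
qed

text \<open>Pairing the expansion of \<open>w j\<close> with \<open>v i\<close> yields exactly the
  sum evaluated by the weak R-dual condition, which says that the Gram matrix of \<open>v\<close>
  reproduces the coefficient sequence.\<close>

lemma weak_R_dual_inner: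
  assumes "is_weak_R_dual w f u v"
  shows "L2_inner (w j) (v i) = L2_inner (f i) (u j)"
proof -
  have v: "parseval_frame v" and wL: "w j \<in> L2"
    and sm: "L2_has_sum (\<lambda>i t. L2_inner (f i) (u j) * v i t) (w j)"
    and rep: "((\<lambda>k. L2_inner (v k) (v i) * L2_inner (f k) (u j)) has_sum L2_inner (f i) (u j)) UNIV"
    using assms unfolding is_weak_R_dual_def by auto
  have "L2_sum_on UNIV (\<lambda>i. L2_inner (f i) (u j)) v (w j)"
    using sm unfolding L2_has_sum_def L2_sum_on_def lincomb_def .
  from L2_sum_on_inner[OF this parseval_frame_L2[OF v] wL parseval_frame_L2[OF v, of i]]
  have "((\<lambda>k. L2_inner (v k) (v i) * L2_inner (f k) (u j)) has_sum L2_inner (w j) (v i)) UNIV"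
    by (simp only: mult.commute)
  from has_sum_unique[OF this rep] show ?thesis .
qed

text \<open>The relation \<open>cross\<close> is linear in \<open>w j\<close> but conjugate-linear
  in \<open>u j\<close>, hence the conjugated coefficients. Parseval's identity for \<open>v\<close>
  then computes the norm of the combination of \<open>w\<close>.\<close>

lemma cross_gram_norm:
  assumes v: "parseval_frame v" and wL: "\<And>j. w j \<in> L2" and uL: "\<And>j. u j \<in> L2" and fL: "\<And>i. f i \<in> L2"
    and cross: "\<And>i j. L2_inner (w j) (v i) = L2_inner (f i) (u j)"
  shows "((\<lambda>i. (cmod (L2_inner (lincomb F c u) (f i)))\<^sup>2) has_sum (L2_norm (lincomb F (\<lambda>j. cnj (c
      j)) w))\<^sup>2) UNIV"
proof -
  have "L2_inner (lincomb F (\<lambda>j. cnj (c j)) w) (v i) = L2_inner (f i) (lincomb F c u)" for i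
    by (simp add: L2_inner_lincomb_left L2_inner_lincomb_right wL uL fL cross parseval_frame_L2[OF v])
  then have "cmod (L2_inner (lincomb F (\<lambda>j. cnj (c j)) w) (v i)) = cmod (L2_inner (lincomb F c u) (f i))" for i
    by (simp only: L2_inner_norm_commute[of "f i"])
  then show ?thesis
    using parseval_frame_has_sum[OF v lincomb_L2[of F w "\<lambda>j. cnj (c j)", OF wL]] by simp
qed

lemma cross_gram_upper:
  assumes v: "parseval_frame v" and wL: "\<And>j. w j \<in> L2" and uL: "\<And>j. u j \<in> L2" and f: "bessel B UNIV f"
    and cross: "\<And>i j. L2_inner (w j) (v i) = L2_inner (f i) (u j)"
  shows "(L2_norm (lincomb F (\<lambda>j. cnj (c j)) w))\<^sup>2 \<le> B * (L2_norm (lincomb F c u))\<^sup>2"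
proof (rule has_sum_le_finite_sums[OF cross_gram_norm[where w = w and u = u and f = f, OF v wL uL _ cross]])
  show "f i \<in> L2" for i by (rule besselD_L2[OF f]) simp
  fix \<Phi> :: "'a set" assume "finite \<Phi>" "\<Phi> \<subseteq> UNIV"
  then show "(\<Sum>i\<in>\<Phi>. (cmod (L2_inner (lincomb F c u) (f i)))\<^sup>2) \<le> B * (L2_norm (lincomb F c u))\<^sup>2"
    using f lincomb_L2[of F u c, OF uL] unfolding bessel_def by blast
qed

text \<open>The source of the upper bound for the adjoint system: \<open>B\<close> passes unchanged
  from \<open>f\<close> to \<open>w\<close>, as synthesis with a Parseval frame has bound
  \<open>1\<close>.\<close>

lemma cross_gram_bessel:
  assumes v: "parseval_frame v" and u: "parseval_frame u" and wL: "\<And>j. w j \<in> L2" and f: "bessel B UNIV f"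
    and cross: "\<And>i j. L2_inner (w j) (v i) = L2_inner (f i) (u j)"
  shows "bessel B UNIV w"
proof (rule besselI[OF wL])
  show B: "0 \<le> B" using f by (simp add: bessel_def)
  fix F c assume F: "finite (F :: 'b set)" "F \<subseteq> UNIV"
  have "bessel 1 UNIV u"
    using u unfolding parseval_frame_def by (rule frame_with_bounds_bessel) simp
  then have u1: "(L2_norm (lincomb F (\<lambda>j. cnj (c j)) u))\<^sup>2 \<le> 1 * (\<Sum>j\<in>F. (cmod (cnj (c j)))\<^sup>2)"
    using F by (rule L2_norm_lincomb_le)
  have "(L2_norm (lincomb F c w))\<^sup>2 \<le> B * (L2_norm (lincomb F (\<lambda>j. cnj (c j)) u))\<^sup>2"
    using cross_gram_upper[where w = w and u = u
        and f = f, OF v wL parseval_frame_L2[OF u] f cross, of F "\<lambda>j. cnj (c j)"] by simp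
  also have "\<dots> \<le> B * (\<Sum>j\<in>F. (cmod (c j))\<^sup>2)"
    using u1 B by (intro mult_left_mono) simp_all
  finally show "(L2_norm (lincomb F c w))\<^sup>2 \<le> B * (\<Sum>j\<in>F. (cmod (c j))\<^sup>2)" .
qed

text \<open>Comparing the lower bound \<open>K\<close> of \<open>w\<close> with the upper bound
  \<open>B\<close> gives \<open>u\<close> the lower Riesz bound \<open>K / B\<close>. The families
  are abstract so that \<open>(w, u)\<close> and \<open>(f, v)\<close> can be exchanged.\<close>

lemma cross_gram_orthonormal:
  assumes v: "parseval_frame v" and u: "parseval_frame u" and wL: "\<And>j. w j \<in> L2" and f: "bessel B UNIV f"
    and cross: "\<And>i j. L2_inner (w j) (v i) = L2_inner (f i) (u j)"
    and B: "0 < B" and K: "0 < K"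
    and lower: "\<And>F c. finite F \<Longrightarrow> K * (\<Sum>j\<in>F. (cmod (c j))\<^sup>2) \<le> (L2_norm (lincomb F c w))\<^sup>2"
  shows "orthonormal_on UNIV u" "total_in L2 UNIV u"
proof -
  have "K / B * (\<Sum>j\<in>F. (cmod (c j))\<^sup>2) \<le> (L2_norm (lincomb F c u))\<^sup>2" if "finite F" for F c
  proof -
    have "K * (\<Sum>j\<in>F. (cmod (c j))\<^sup>2) \<le> (L2_norm (lincomb F (\<lambda>j. cnj (c j)) w))\<^sup>2"
      using lower[OF that, of "\<lambda>j. cnj (c j)"] by simp
    also have "\<dots> \<le> B * (L2_norm (lincomb F c u))\<^sup>2"
      by (rule cross_gram_upper[where w = w and u = u and f = f, OF v wL parseval_frame_L2[OF u] f cross])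
    finally show ?thesis using B by (simp add: pos_divide_le_eq mult.commute)
  qed
  note low = this
  have KB: "0 < K / B" using K B by simp
  show "orthonormal_on UNIV u"
    by (rule parseval_frame_lower_riesz_orthonormal(1)[OF u KB low])
  show "total_in L2 UNIV u"
    by (rule parseval_frame_lower_riesz_orthonormal(2)[OF u KB low])
qed

text \<open>Let \<open>Q\<close> be the right-hand side. For a finite combination \<open>z\<close>
  of \<open>w\<close>, Cauchy-Schwarz and the lower Riesz bound give that \<open>K\<close> times the
  squared modulus of \<open>L2_inner x z\<close> is at most \<open>Q\<close> times the squared norm
  of \<open>z\<close>. Letting \<open>z\<close> approach \<open>x\<close> gives the claim after
  cancellation.\<close>

lemma lower_riesz_total_frame_bound:
  assumes w: "bessel B UNIV w" and K: "0 < K"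
    and lower: "\<And>F c. finite F \<Longrightarrow> K * (\<Sum>j\<in>F. (cmod (c j))\<^sup>2) \<le> (L2_norm (lincomb F c w))\<^sup>2"
    and tot: "total_in L2 UNIV w" and x: "x \<in> L2"
  shows "K * (L2_norm x)\<^sup>2 \<le> (\<Sum>\<^sub>\<infinity>j. (cmod (L2_inner x (w j)))\<^sup>2)"
proof -
  define Q where "Q = (\<Sum>\<^sub>\<infinity>j. (cmod (L2_inner x (w j)))\<^sup>2)"
  have Q: "0 \<le> Q" unfolding Q_def by (rule infsum_nonneg) simp
  have wL: "\<And>j. w j \<in> L2" by (rule besselD_L2[OF w]) simp
  \<comment> \<open>Totality becomes density: projecting \<open>x\<close> onto the closed span
    leaves a remainder orthogonal to every \<open>w j\<close>, hence null.\<close>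
  obtain y where y: "y \<in> closed_span w" and "\<And>z. z \<in> closed_span w \<Longrightarrow> L2_inner (\<lambda>t. x t - y t) z = 0"
    by (rule orthogonal_projection[OF closed_subspace_closed_span[of w, OF wL] x]) (erule that, blast)
  then have orth: "L2_inner (\<lambda>t. x t - y t) (w j) = 0" for j
    using in_closed_span[of w j, OF wL] by blast
  have yL: "y \<in> L2" using y by (simp add: closed_span_def)
  have xy: "L2_norm (\<lambda>t. x t - y t) = 0"
    using tot orth L2_diff[OF x yL] unfolding total_in_def by simp
  have ineq: "sqrt K * ((L2_norm x)\<^sup>2 - L2_norm x * \<epsilon>) \<le> (L2_norm x + \<epsilon>) * sqrt Q" if \<epsilon>: "0 < \<epsilon>" for \<epsilon>
  proof -
    obtain F c where F: "finite F" "L2_norm (\<lambda>t. y t - lincomb F c w t) < \<epsilon>"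
      using y \<epsilon> unfolding closed_span_def by auto
    define z where "z = lincomb F c w"
    have zL: "z \<in> L2" unfolding z_def by (rule lincomb_L2) (rule wL)
    have xz: "L2_norm (\<lambda>t. x t - z t) \<le> \<epsilon>"
      using L2_norm_triangle_mid[OF x yL zL] F(2) xy by (simp add: z_def)
    define S where "S = (\<Sum>j\<in>F. (cmod (c j))\<^sup>2)"
    have S: "0 \<le> S" unfolding S_def by (rule sum_nonneg) simp
    have "(cmod (L2_inner x z))\<^sup>2 \<le> S * Q"
    proof -
      have "cmod (L2_inner x z) \<le> (\<Sum>j\<in>F. cmod (c j) * cmod (L2_inner x (w j)))"
        unfolding z_def L2_inner_lincomb_right[of F w, OF wL x]
        by (rule order_trans[OF norm_sum]) (simp add: norm_mult)
      then have "(cmod (L2_inner x z))\<^sup>2 \<le> (\<Sum>j\<in>F. cmod (c j) * cmod (L2_inner x (w j)))\<^sup>2"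
        by (rule power_mono) simp
      also have "\<dots> \<le> S * (\<Sum>j\<in>F. (cmod (L2_inner x (w j)))\<^sup>2)"
        unfolding S_def by (rule Cauchy_Schwarz_ineq_sum)
      also have "\<dots> \<le> S * Q"
        unfolding Q_def using S F bessel_summable[OF w x] by (intro mult_left_mono finite_sum_le_infsum) auto
      finally show ?thesis .
    qed
    then have "K * (cmod (L2_inner x z))\<^sup>2 \<le> (K * S) * Q"
      using K by (simp add: mult.assoc)
    also have "\<dots> \<le> (L2_norm z)\<^sup>2 * Q"
      using lower[OF F(1), of c] Q unfolding S_def z_def by (rule mult_right_mono)
    finally have "sqrt K * cmod (L2_inner x z) \<le> L2_norm z * sqrt Q"
      using real_sqrt_le_mono[of "K * (cmod (L2_inner x z))\<^sup>2" "(L2_norm z)\<^sup>2 * Q"]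
      by (simp add: real_sqrt_mult)
    moreover have "(L2_norm x)\<^sup>2 - L2_norm x * \<epsilon> \<le> cmod (L2_inner x z)"
    proof -
      have "L2_inner x (\<lambda>t. x t - z t) = of_real ((L2_norm x)\<^sup>2) - L2_inner x z"
        by (simp only: L2_inner_diff_right[OF x zL x] L2_inner_self)
      then have "(L2_norm x)\<^sup>2 = cmod (L2_inner x (\<lambda>t. x t - z t) + L2_inner x z)"
        by (simp del: of_real_power)
      also have "\<dots> \<le> L2_norm x * L2_norm (\<lambda>t. x t - z t) + cmod (L2_inner x z)"
        using norm_triangle_ineq L2_Cauchy_Schwarz[OF x L2_diff[OF x zL]]
        by (rule order_trans[OF _ add_right_mono])
      also have "\<dots> \<le> L2_norm x * \<epsilon> + cmod (L2_inner x z)"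
        using xz by (intro add_right_mono mult_left_mono) auto
      finally show ?thesis by simp
    qed
    then have "sqrt K * ((L2_norm x)\<^sup>2 - L2_norm x * \<epsilon>) \<le> sqrt K * cmod (L2_inner x z)"
      using K by (intro mult_left_mono) auto
    moreover have "L2_norm z * sqrt Q \<le> (L2_norm x + \<epsilon>) * sqrt Q"
    proof (rule mult_right_mono)
      have "L2_norm z = L2_norm (\<lambda>t. x t - (x t - z t))" by simp
      also have "\<dots> \<le> L2_norm x + L2_norm (\<lambda>t. x t - z t)"
        by (rule L2_norm_triangle_diff[OF x L2_diff[OF x zL]])
      finally show "L2_norm z \<le> L2_norm x + \<epsilon>" using xz by simp
    qed (use Q in simp)
    ultimately show ?thesis by linarith
  qed
  have "\<forall>\<^sub>F \<epsilon> in at_right 0. sqrt K * ((L2_norm x)\<^sup>2 - L2_norm x * \<epsilon>) \<le> (L2_norm x + \<epsilon>) * sqrt Q"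
    using eventually_at_right_less[of 0] by eventually_elim (rule ineq)
  moreover have "((\<lambda>\<epsilon>. sqrt K * ((L2_norm x)\<^sup>2 - L2_norm x * \<epsilon>)) \<longlongrightarrow> sqrt K * ((L2_norm x)\<^sup>2 -
      L2_norm x * 0)) (at_right 0)"
    by (intro tendsto_intros)
  moreover have "((\<lambda>\<epsilon>. (L2_norm x + \<epsilon>) * sqrt Q) \<longlongrightarrow> (L2_norm x + 0) * sqrt Q) (at_right 0)"
    by (intro tendsto_intros)
  ultimately have "sqrt K * ((L2_norm x)\<^sup>2 - L2_norm x * 0) \<le> (L2_norm x + 0) * sqrt Q"
    using tendsto_le[OF trivial_limit_at_right_real] by blast
  then have "sqrt K * L2_norm x * L2_norm x \<le> sqrt Q * L2_norm x"
    by (simp add: power2_eq_square mult_ac)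
  then have "sqrt K * L2_norm x \<le> sqrt Q"
    using L2_norm_nonneg[of x] Q by (cases "L2_norm x = 0") (auto simp: mult_le_cancel_right)
  then have "(sqrt K * L2_norm x)\<^sup>2 \<le> (sqrt Q)\<^sup>2"
    using K by (intro power_mono) auto
  then show ?thesis using K Q by (simp add: power_mult_distrib Q_def[symmetric])
qed

lemma L2_norm_tail_tendsto_0:
  assumes x: "x \<in> L2" and c: "c > 0"
  shows "(\<lambda>n. L2_norm (\<lambda>t. indicator {t. real n * c \<le> \<bar>t\<bar>} t * x t)) \<longlonglongrightarrow> 0"
proof -
  note [measurable] = L2_measurable[OF x]
  have "(\<lambda>n. \<integral>t. (cmod (indicator {t. real n * c \<le> \<bar>t\<bar>} t * x t))\<^sup>2 \<partial>lborel) \<longlonglongrightarrow> (\<integral>t. (\<lambda>t::real. 0) t \<partial>lborel)"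
  proof (rule integral_dominated_convergence[where w = "\<lambda>t. (cmod (x t))\<^sup>2"])
    show "integrable lborel (\<lambda>t. (cmod (x t))\<^sup>2)" by (rule L2_integrable_square[OF x])
    show "AE t in lborel. (\<lambda>n. (cmod (indicator {t. real n * c \<le> \<bar>t\<bar>} t * x t))\<^sup>2) \<longlonglongrightarrow> 0"
    proof (rule AE_I2, rule tendsto_eventually)
      fix t
      obtain N :: nat where "\<bar>t\<bar> / c < real N" using reals_Archimedean2 by blast
      then have N: "\<bar>t\<bar> < real N * c" using c by (simp add: pos_divide_less_eq)
      show "\<forall>\<^sub>F n in sequentially. (cmod (indicator {t. real n * c \<le> \<bar>t\<bar>} t * x t))\<^sup>2 = 0"
      proof (rule eventually_sequentiallyI)
        fix n assume "N \<le> n"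
        then have "real N * c \<le> real n * c" using c by simp
        then show "(cmod (indicator {t. real n * c \<le> \<bar>t\<bar>} t * x t))\<^sup>2 = 0" using N by (simp add: indicator_def)
      qed
    qed
  qed (auto simp: indicator_def)
  from tendsto_real_sqrt[OF this] show ?thesis by (simp add: L2_norm_def)
qed

section \<open>Translation invariant subspaces\<close>

text \<open>Cut \<open>y\<close> at half the shift. Where \<open>\<bar>t\<bar>\<close> is below
  \<open>n s / 2\<close>, the point \<open>t + n s\<close> has modulus at least
  \<open>n s / 2\<close>, so the core of \<open>y\<close> meets only the tail of \<open>x\<close>.
  Both tails tend to zero in norm.\<close>

lemma L2_inner_translation_tendsto_0:
  assumes x: "x \<in> L2" and y: "y \<in> L2" and s: "s > 0"
  shows "(\<lambda>n. L2_inner (\<lambda>t. x (t + real n * s)) y) \<longlonglongrightarrow> 0"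
proof -
  define tail where "tail n z t = indicator {t. real n * (s / 2) \<le> \<bar>t\<bar>} t * z t" for n
      and z :: "real \<Rightarrow> complex" and t
  have tailL: "tail n z \<in> L2" if "z \<in> L2" for n z
    unfolding tail_def[abs_def] by (rule L2_restrict[OF that]) measurable
  have lim: "(\<lambda>n. L2_norm (tail n z)) \<longlonglongrightarrow> 0" if "z \<in> L2" for z
    using L2_norm_tail_tendsto_0[OF that, of "s / 2"] s by (simp add: tail_def[abs_def])
  have le: "cmod (L2_inner (\<lambda>t. x (t + real n * s)) y)
      \<le> L2_norm x * L2_norm (tail n y) + L2_norm (tail n x) * L2_norm y" for n
  proof -
    define xn where "xn t = x (t + real n * s)" for t
    define tn where "tn t = tail n x (t + real n * s)" for t
    define yn where "yn t = y t - tail n y t" for t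
    have xnL: "xn \<in> L2" and tnL: "tn \<in> L2"
      unfolding xn_def[abs_def] tn_def[abs_def] using L2_translation x tailL by blast+
    have ynL: "yn \<in> L2" unfolding yn_def[abs_def] using y tailL by simp
    have yn_le: "L2_norm yn \<le> L2_norm y"
      unfolding L2_norm_def
    proof (rule real_sqrt_le_mono, rule integral_mono)
      show "integrable lborel (\<lambda>t. (cmod (yn t))\<^sup>2)" "integrable lborel (\<lambda>t. (cmod (y t))\<^sup>2)"
        using ynL y by (auto intro: L2_integrable_square)
      show "(cmod (yn t))\<^sup>2 \<le> (cmod (y t))\<^sup>2" for t
        by (simp add: yn_def tail_def indicator_def)
    qed
    have "L2_inner xn yn = L2_inner tn yn"
      unfolding L2_inner_def
    proof (rule Bochner_Integration.integral_cong[OF refl])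
      fix t
      have "yn t = 0 \<or> tn t = xn t"
      proof (cases "real n * (s / 2) \<le> \<bar>t\<bar>")
        case False
        have "real n * s = 2 * (real n * (s / 2))" by simp
        then have "real n * (s / 2) \<le> \<bar>t + real n * s\<bar>" using False by linarith
        then show ?thesis by (simp add: tn_def xn_def tail_def)
      qed (simp add: yn_def tail_def)
      then show "xn t * cnj (yn t) = tn t * cnj (yn t)" by auto
    qed
    moreover have "L2_inner xn yn = L2_inner xn y - L2_inner xn (tail n y)"
      unfolding yn_def[abs_def] using xnL y tailL by (intro L2_inner_diff_right)
    ultimately have "L2_inner xn y = L2_inner xn (tail n y) + L2_inner tn yn" by (simp add: algebra_simps)
    then have "cmod (L2_inner xn y) \<le> cmod (L2_inner xn (tail n y)) + cmod (L2_inner tn yn)"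
      by (simp add: norm_triangle_ineq)
    also have "\<dots> \<le> L2_norm xn * L2_norm (tail n y) + L2_norm tn * L2_norm yn"
      by (intro add_mono L2_Cauchy_Schwarz xnL tnL ynL tailL y)
    also have "L2_norm xn = L2_norm x" unfolding xn_def[abs_def] by (rule L2_norm_translation)
    also have "L2_norm tn = L2_norm (tail n x)" unfolding tn_def[abs_def] by (rule L2_norm_translation)
    also have "L2_norm (tail n x) * L2_norm yn \<le> L2_norm (tail n x) * L2_norm y"
      using yn_le by (rule mult_left_mono) simp
    finally show ?thesis by (simp add: xn_def[abs_def])
  qed
  have "(\<lambda>n. L2_norm x * L2_norm (tail n y) + L2_norm (tail n x) * L2_norm y) \<longlonglongrightarrow> L2_norm x * 0 + 0 * L2_norm y"
    by (intro tendsto_intros lim x y)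
  then have "(\<lambda>n. L2_norm x * L2_norm (tail n y) + L2_norm (tail n x) * L2_norm y) \<longlonglongrightarrow> 0" by simp
  then show ?thesis by (rule Lim_null_comparison[rotated]) (intro always_eventually allI le)
qed

text \<open>A finite-dimensional translation invariant subspace is trivial: the coefficients of \<open>g(\<cdot> + n s)\<close> in a finite
  orthonormal basis tend to \<open>0\<close>, but the norm does not change.\<close>

lemma translation_invariant_infinite:
  assumes M: "closed_subspace M" and s: "s > 0" and inv: "\<And>x n. x \<in> M \<Longrightarrow> (\<lambda>t. x (t + real n * s)) \<in> M"
    and S: "S \<subseteq> M" "orthonormal_on S (\<lambda>g. g)" "total_in M S (\<lambda>g. g)" and ne: "S \<noteq> {}"
  shows "infinite S"
proof
  assume fin: "finite S"
  obtain g where g: "g \<in> S" using ne by blast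
  then have gM: "g \<in> M" and g1: "L2_norm g = 1" using S(1) orthonormal_on_norm[OF S(2) g] by auto
  have gL: "g \<in> L2" by (rule closed_subspace_L2[OF M gM])
  have sum1: "(\<Sum>e\<in>S. (cmod (L2_inner (\<lambda>t. g (t + real n * s)) e))\<^sup>2) = 1" for n
  proof -
    have "((\<lambda>e. (cmod (L2_inner (\<lambda>t. g (t + real n * s)) e))\<^sup>2) has_sum (L2_norm (\<lambda>t. g (t + real n * s)))\<^sup>2) S"
      by (rule orthonormal_total_norm[OF M S(2) _ S(3) inv[OF gM]]) (use S(1) in blast)
    from has_sum_unique[OF this has_sum_finite[OF fin]] show ?thesis
      by (simp add: L2_norm_translation g1)
  qed
  have "(\<lambda>n. \<Sum>e\<in>S. (cmod (L2_inner (\<lambda>t. g (t + real n * s)) e))\<^sup>2) \<longlonglongrightarrow> (\<Sum>e\<in>S. 0\<^sup>2)"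
  proof (intro tendsto_sum tendsto_power tendsto_norm_zero)
    fix e assume "e \<in> S"
    then have "e \<in> L2" using S(1) closed_subspace_L2[OF M] by blast
    then show "(\<lambda>n. L2_inner (\<lambda>t. g (t + real n * s)) e) \<longlonglongrightarrow> 0"
      by (rule L2_inner_translation_tendsto_0[OF gL _ s])
  qed
  then have "(\<lambda>n::nat. 1 :: real) \<longlonglongrightarrow> 0" unfolding sum1 by simp
  then show False using LIMSEQ_unique[OF tendsto_const] by fastforce
qed

text \<open>Translation by a multiple of \<open>1/b\<close> permutes the adjoint system up to
  unimodular constants such as \<open>k\<close>: only the translation index moves. Its orthogonal
  complement is therefore invariant too.\<close>

lemma adjoint_complement_translation:
  assumes a: "a > 0" and b: "b > 0" and f: "f \<in> L2"
    and x: "x \<in> orthogonal_complement (range (adjoint_system a b f))"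
  shows "(\<lambda>t. x (t + real n * (1 / b))) \<in> orthogonal_complement (range (adjoint_system a b f))"
proof -
  have xL: "x \<in> L2" using x by (simp add: orthogonal_complement_def)
  have "L2_inner (\<lambda>t. x (t + real n * (1 / b))) (adjoint_system a b f (m, l)) = 0" for m l
  proof -
    define k where "k = wave (of_int m / a) (- (real n * (1 / b)))"
    have "adjoint_system a b f (m, l) t = k * adjoint_system a b f (m, l + int n) (t + real n * (1 / b))" for t
    proof -
      have e1: "wave (of_int m / a) t = k * wave (of_int m / a) (t + real n * (1 / b))"
        unfolding k_def wave_add[symmetric] by (simp add: add.commute)
      have e2: "t + real n * (1 / b) - of_int (l + int n) / b = t - of_int l / b"
        by (simp add: add_divide_distrib)
      show ?thesis unfolding adjoint_system_wave e2 by (subst e1) (simp only: mult_ac)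
    qed
    then have "L2_inner (\<lambda>t. x (t + real n * (1 / b))) (adjoint_system a b f (m, l))
        = L2_inner (\<lambda>t. x (t + real n * (1 / b))) (\<lambda>t. k * adjoint_system a b f (m, l + int n) (t
            + real n * (1 / b)))"
      by presburger
    also have "\<dots> = cnj (k * L2_inner (adjoint_system a b f (m, l + int n)) x)"
      by (subst L2_inner_cnj[symmetric], subst L2_inner_scale_left, subst L2_inner_translation) (rule refl)
    also have "\<dots> = cnj k * L2_inner x (adjoint_system a b f (m, l + int n))"
      by (simp add: L2_inner_cnj)
    also have "\<dots> = 0" using x by (simp add: orthogonal_complement_def)
    finally show ?thesis .
  qed
  then show ?thesis using L2_translation[OF xL] by (auto simp: orthogonal_complement_def)
qed

section \<open>From weak R-duals to R-duals\<close>

lemma has_sum_cong_unique: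
  fixes F G :: "'a \<Rightarrow> 'b::{topological_comm_monoid_add, t2_space}"
  assumes "(F has_sum p) T" "(G has_sum q) T" "\<And>s. s \<in> T \<Longrightarrow> F s = G s"
  shows "p = q"
proof -
  have "(F has_sum q) T" using assms(2,3) by (simp cong: has_sum_cong)
  with assms(1) show ?thesis by (rule has_sum_unique)
qed

text \<open>On an orthonormal basis \<open>S\<^sub>0\<close> of the closed span of \<open>w\<close> the operator \<open>V x = \<Sum>\<^sub>i \<langle>x, v\<^sub>i\<rangle> u\<^sub>i\<close> is
  an isometry. Its image of \<open>S\<^sub>0\<close> has an infinite-dimensional complement, because \<open>V S\<^sub>1\<close> lies in it, so \<open>V\<close>
  restricted to the span extends to a unitary operator, whose adjoint sends \<open>u\<close> to the new basis.\<close>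

lemma weak_R_dual_extend:
  fixes f u v w :: "'i::countable \<Rightarrow> real \<Rightarrow> complex"
  assumes weak: "is_weak_R_dual w f u v"
    and onu: "orthonormal_on UNIV u" and totu: "total_in L2 UNIV u"
    and S1: "S1 \<subseteq> orthogonal_complement (range w)" "orthonormal_on S1 (\<lambda>s. s)"
      "total_in (orthogonal_complement (range w)) S1 (\<lambda>s. s)" "infinite S1"
  shows "\<exists>v'. is_R_dual w f u v'"
proof -
  have v: "parseval_frame v" and wL: "w j \<in> L2" and ws: "range w \<subseteq> L2" for j
    using weak by (auto simp: is_weak_R_dual_def)
  have uL: "u i \<in> L2" for i by (rule orthonormal_on_L2[OF onu]) simp
  have beu: "bessel 1 UNIV u" by (rule orthonormal_on_bessel[OF onu])
  have vL: "v i \<in> L2" for i by (rule parseval_frame_L2[OF v])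
  have bev: "bessel 1 UNIV v"
    using v unfolding parseval_frame_def by (rule frame_with_bounds_bessel) simp
  have S1L: "s \<in> L2" if "s \<in> S1" for s using S1(1) that by (auto simp: orthogonal_complement_def)
  then have S1s: "S1 \<subseteq> L2" by blast
  have cs1: "closed_subspace (orthogonal_complement S1)"
    by (rule closed_subspace_orthogonal_complement[OF S1s])
  \<comment> \<open>The complement of \<open>S1\<close> contains every \<open>w j\<close> and stands
    for their closed span; \<open>S0\<close> and \<open>S1\<close> together are total in
    \<open>L2\<close>.\<close>
  obtain S0 where S0: "S0 \<subseteq> orthogonal_complement S1" "orthonormal_on S0 (\<lambda>s. s)"
      "total_in (orthogonal_complement S1) S0 (\<lambda>s. s)"
    by (rule closed_subspace_orthonormal_total[OF cs1])
  have S0L: "s \<in> L2" if "s \<in> S0" for s using S0(1) that by (auto simp: orthogonal_complement_def)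
  have S01: "L2_inner s t = 0" if "s \<in> S0" "t \<in> S1" for s t
    using S0(1) that by (auto simp: orthogonal_complement_def)
  have S10: "L2_inner t s = 0" if "s \<in> S0" "t \<in> S1" for s t
    using S01[OF that] L2_inner_cnj[of s t] by simp
  have S01_disj: "s \<noteq> t" if "s \<in> S0" "t \<in> S1" for s t
    using S01[OF that] orthonormal_on_inner[OF S1(2) that(2) that(2)] by auto
  define T where "T = S0 \<union> S1"
  have TL: "s \<in> L2" if "s \<in> T" for s using that S0L S1L by (auto simp: T_def)
  have onT: "orthonormal_on T (\<lambda>s. s)"
    unfolding orthonormal_on_def
  proof (intro conjI ballI)
    show "(\<lambda>s. s) ` T \<subseteq> L2" using TL by blast
    fix s t assume "s \<in> T" "t \<in> T"
    then consider "s \<in> S0" "t \<in> S0" | "s \<in> S0" "t \<in> S1" | "s \<in> S1" "t \<in> S0" | "s \<in> S1" "t \<in> S1"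
      by (auto simp: T_def)
    then show "L2_inner s t = (if s = t then 1 else 0)"
    proof cases
      case 1 then show ?thesis by (rule orthonormal_on_inner[OF S0(2)])
    next
      case 2 then show ?thesis using S01 S01_disj by auto
    next
      case 3 then show ?thesis using S10 S01_disj by auto
    next
      case 4 then show ?thesis by (rule orthonormal_on_inner[OF S1(2)])
    qed
  qed
  have totT: "total_in L2 T (\<lambda>s. s)"
    unfolding total_in_def
  proof (intro ballI impI)
    fix x assume "x \<in> L2" and 0: "\<forall>s\<in>T. L2_inner x s = 0"
    then have "x \<in> orthogonal_complement S1" by (simp add: orthogonal_complement_def T_def)
    then show "L2_norm x = 0" using S0(3) 0 by (simp add: total_in_def T_def)
  qed
  have "\<forall>x\<in>L2. \<exists>y. y \<in> L2 \<and> L2_sum_on UNIV (\<lambda>i. L2_inner x (v i)) u y"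
  proof
    fix x assume x: "x \<in> L2"
    obtain y where "y \<in> L2" "L2_sum_on UNIV (\<lambda>i. L2_inner x (v i)) u y"
      by (rule L2_Riesz_Fischer[OF beu bessel_summable[OF bev x]])
    then show "\<exists>y. y \<in> L2 \<and> L2_sum_on UNIV (\<lambda>i. L2_inner x (v i)) u y" by (intro exI conjI)
  qed
  from bchoice[OF this] obtain V where VL: "\<And>x. x \<in> L2 \<Longrightarrow> V x \<in> L2"
      and V: "\<And>x. x \<in> L2 \<Longrightarrow> L2_sum_on UNIV (\<lambda>i. L2_inner x (v i)) u (V x)"
    by blast
  have Vu: "L2_inner (V x) (u i) = L2_inner x (v i)" if "x \<in> L2" for x i
    by (rule L2_sum_on_coefficient[OF onu V[OF that] VL[OF that]]) simp
  \<comment> \<open>Since \<open>V\<close> turns \<open>v\<close>-coefficients into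
    \<open>u\<close>-coefficients, both inner products are the same sum, by the Parseval property of
    \<open>v\<close>.\<close>
  have Viso: "L2_inner (V x) (V y) = L2_inner x y" if x: "x \<in> L2" and y: "y \<in> L2" for x y
  proof -
    have uV: "L2_inner (u i) (V y) = L2_inner (v i) y" for i
      using Vu[OF y, of i] by (metis L2_inner_cnj)
    have "((\<lambda>i. L2_inner x (v i) * L2_inner (u i) (V y)) has_sum L2_inner (V x) (V y)) UNIV"
      by (rule L2_sum_on_inner[OF V[OF x] uL VL[OF x] VL[OF y]])
    then show ?thesis
      unfolding uV using parseval_frame_inner[OF v x y] by (rule has_sum_unique)
  qed
  have V0s: "V ` S0 \<subseteq> L2" using VL S0L by blast
  have cs2: "closed_subspace (orthogonal_complement (V ` S0))"
    by (rule closed_subspace_orthogonal_complement[OF V0s])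
  obtain S2 where S2: "S2 \<subseteq> orthogonal_complement (V ` S0)" "orthonormal_on S2 (\<lambda>s. s)"
      "total_in (orthogonal_complement (V ` S0)) S2 (\<lambda>s. s)"
    by (rule closed_subspace_orthonormal_total[OF cs2])
  have infS2: "infinite S2"
  proof
    assume fin: "finite S2"
    have onV: "orthonormal_on S1 V"
      unfolding orthonormal_on_def
    proof (intro conjI ballI)
      show "V ` S1 \<subseteq> L2" using VL S1L by blast
      fix s t assume "s \<in> S1" "t \<in> S1"
      then show "L2_inner (V s) (V t) = (if s = t then 1 else 0)"
        using Viso[OF S1L S1L] orthonormal_on_inner[OF S1(2)] by simp
    qed
    have V1: "V s \<in> orthogonal_complement (V ` S0)" if "s \<in> S1" for s
      using VL[OF S1L[OF that]] Viso[OF S1L[OF that] S0L] S10[OF _ that]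
      by (auto simp: orthogonal_complement_def)
    have "finite S1"
      by (rule orthonormal_in_finite_dimensional[OF cs2 onV V1 S2(2) _ S2(3) fin]) (assumption,
          erule subsetD[OF S2(1)])
    then show False using S1(4) by blast
  qed
  have pu: "parseval_frame u"
    using weak by (simp add: is_weak_R_dual_def)
  have cS1: "countable S1" by (rule orthonormal_on_countable[OF pu S1(2)])
  have cS2: "countable S2" by (rule orthonormal_on_countable[OF pu S2(2)])
  \<comment> \<open>Both complements have countably infinite orthonormal bases, so any bijection
    between these can complete \<open>V\<close>.\<close>
  obtain \<phi> where \<phi>: "bij_betw \<phi> S1 S2"
    by (rule that[OF bij_betw_trans[OF to_nat_on_infinite[OF cS1 S1(4)] bij_betw_from_nat_into[OF cS2 infS2]]])
  have \<phi>S2: "\<phi> s \<in> S2" if "s \<in> S1" for s using bij_betwE[OF \<phi>] that by blast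
  have S2L: "s \<in> L2" if "s \<in> S2" for s using S2(1) that by (auto simp: orthogonal_complement_def)
  have S2V: "L2_inner t (V s) = 0" if "s \<in> S0" "t \<in> S2" for s t
    using S2(1) that by (auto simp: orthogonal_complement_def)
  have VS2: "L2_inner (V s) t = 0" if "s \<in> S0" "t \<in> S2" for s t
    using S2V[OF that] L2_inner_cnj[of t "V s"] by simp
  define \<psi> where "\<psi> s = (if s \<in> S0 then V s else \<phi> s)" for s
  have \<psi>0: "\<psi> s = V s" if "s \<in> S0" for s using that by (simp add: \<psi>_def)
  have \<psi>1: "\<psi> s = \<phi> s" if "s \<in> S1" for s using that S01_disj by (auto simp: \<psi>_def)
  have \<psi>L: "\<psi> s \<in> L2" if "s \<in> T" for s
  proof (cases "s \<in> S0")
    case True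
    then show ?thesis using VL[OF S0L[OF True]] \<psi>0 by simp
  next
    case False
    then have "s \<in> S1" using that by (simp add: T_def)
    then show ?thesis using S2L[OF \<phi>S2] \<psi>1 by simp
  qed
  have on\<psi>: "orthonormal_on T \<psi>"
    unfolding orthonormal_on_def
  proof (intro conjI ballI)
    show "\<psi> ` T \<subseteq> L2" using \<psi>L by blast
    fix s t assume "s \<in> T" "t \<in> T"
    then consider "s \<in> S0" "t \<in> S0" | "s \<in> S0" "t \<in> S1" | "s \<in> S1" "t \<in> S0" | "s \<in> S1" "t \<in> S1"
      by (auto simp: T_def)
    then show "L2_inner (\<psi> s) (\<psi> t) = (if s = t then 1 else 0)"
    proof cases
      case 1 then show ?thesis using Viso[OF S0L S0L] orthonormal_on_inner[OF S0(2)] \<psi>0 by simp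
    next
      case 2 then show ?thesis using VS2[OF _ \<phi>S2] S01_disj \<psi>0 \<psi>1 by auto
    next
      case 3 then show ?thesis using S2V[OF _ \<phi>S2] S01_disj \<psi>0 \<psi>1 by auto
    next
      case 4
      then have "L2_inner (\<phi> s) (\<phi> t) = (if \<phi> s = \<phi> t then 1 else 0)"
        by (intro orthonormal_on_inner[OF S2(2)] \<phi>S2)
      moreover have "\<phi> s = \<phi> t \<longleftrightarrow> s = t"
        using 4 bij_betw_imp_inj_on[OF \<phi>] by (auto dest: inj_onD)
      ultimately show ?thesis using 4 \<psi>1 by simp
    qed
  qed
  have tot\<psi>: "total_in L2 T \<psi>"
    unfolding total_in_def
  proof (intro ballI impI)
    fix x assume x: "x \<in> L2" and 0: "\<forall>s\<in>T. L2_inner x (\<psi> s) = 0"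
    have "L2_inner x (V s) = 0" if "s \<in> S0" for s
      using bspec[OF 0, of s] that \<psi>0[OF that] by (simp add: T_def)
    then have "x \<in> orthogonal_complement (V ` S0)" using x by (auto simp: orthogonal_complement_def)
    moreover have "L2_inner x t = 0" if "t \<in> S2" for t
    proof -
      have "t \<in> \<phi> ` S1" using bij_betw_imp_surj_on[OF \<phi>] that by simp
      then obtain s where s: "t = \<phi> s" "s \<in> S1" by (rule imageE)
      then show ?thesis using bspec[OF 0, of s] \<psi>1[OF s(2)] by (simp add: T_def)
    qed
    ultimately show "L2_norm x = 0" using S2(3) by (simp add: total_in_def)
  qed
  have beT: "bessel 1 T (\<lambda>s. s)" by (rule orthonormal_on_bessel[OF onT])
  have be\<psi>: "bessel 1 T \<psi>" by (rule orthonormal_on_bessel[OF on\<psi>])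
  have expT: "L2_sum_on T (\<lambda>s. L2_inner x s) (\<lambda>s. s) x" if "x \<in> L2" for x
    by (rule orthonormal_total_expansion[OF closed_subspace_UNIV onT TL totT that])
  have exp\<psi>: "L2_sum_on T (\<lambda>s. L2_inner x (\<psi> s)) \<psi> x" if "x \<in> L2" for x
    by (rule orthonormal_total_expansion[OF closed_subspace_UNIV on\<psi> \<psi>L tot\<psi> that])
  \<comment> \<open>\<open>\<psi>\<close> gives the values on \<open>T\<close> of the unitary
    extension. The coefficients of its adjoint at \<open>u i\<close> along \<open>s\<close> are
    \<open>L2_inner (u i) (\<psi> s)\<close>, which defines \<open>v' i\<close>.\<close>
  have "\<forall>i. \<exists>y. y \<in> L2 \<and> L2_sum_on T (\<lambda>s. L2_inner (u i) (\<psi> s)) (\<lambda>s. s) y"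
  proof
    fix i
    obtain y where "y \<in> L2" "L2_sum_on T (\<lambda>s. L2_inner (u i) (\<psi> s)) (\<lambda>s. s) y"
      by (rule L2_Riesz_Fischer[OF beT bessel_summable[OF be\<psi> uL]])
    then show "\<exists>y. y \<in> L2 \<and> L2_sum_on T (\<lambda>s. L2_inner (u i) (\<psi> s)) (\<lambda>s. s) y" by (intro exI conjI)
  qed
  from choice[OF this] obtain v' where v'L: "\<And>i. v' i \<in> L2"
      and v': "\<And>i. L2_sum_on T (\<lambda>s. L2_inner (u i) (\<psi> s)) (\<lambda>s. s) (v' i)"
    by blast
  have v's: "L2_inner (v' i) s = L2_inner (u i) (\<psi> s)" if "s \<in> T" for i s
    by (rule L2_sum_on_coefficient[OF onT v' v'L that])
  have sv': "L2_inner s (v' i) = L2_inner (\<psi> s) (u i)" if "s \<in> T" for i s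
    using v's[OF that, of i] by (metis L2_inner_cnj)
  have onv': "orthonormal_on UNIV v'"
    unfolding orthonormal_on_def
  proof (intro conjI ballI)
    show "range v' \<subseteq> L2" using v'L by blast
    fix i k :: 'i
    have "((\<lambda>s. L2_inner (u i) (\<psi> s) * L2_inner s (v' k)) has_sum L2_inner (v' i) (v' k)) T"
      by (rule L2_sum_on_inner[OF v' TL v'L v'L])
    moreover have "((\<lambda>s. L2_inner (u i) (\<psi> s) * L2_inner (\<psi> s) (u k)) has_sum L2_inner (u i) (u k)) T"
      by (rule L2_sum_on_inner[OF exp\<psi>[OF uL] \<psi>L uL uL])
    ultimately have "L2_inner (v' i) (v' k) = L2_inner (u i) (u k)"
      by (rule has_sum_cong_unique) (simp only: sv')
    then show "L2_inner (v' i) (v' k) = (if i = k then 1 else 0)"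
      using orthonormal_on_inner[OF onu UNIV_I UNIV_I] by simp
  qed
  have totv': "total_in L2 UNIV v'"
    unfolding total_in_def
  proof (intro ballI impI)
    fix x assume x: "x \<in> L2" and 0: "\<forall>i\<in>UNIV. L2_inner x (v' i) = 0"
    \<comment> \<open>The image of \<open>x\<close> under the unitary operator; its
      \<open>u\<close>-coefficients are the \<open>v'\<close>-coefficients of
      \<open>x\<close>.\<close>
    obtain y where y: "y \<in> L2" "L2_sum_on T (\<lambda>s. L2_inner x s) \<psi> y"
      by (rule L2_Riesz_Fischer[OF be\<psi> bessel_summable[OF beT x]])
    have "L2_inner y (u i) = 0" for i
    proof -
      have "((\<lambda>s. L2_inner x s * L2_inner s (v' i)) has_sum L2_inner x (v' i)) T"
        by (rule L2_sum_on_inner[OF expT[OF x] TL x v'L])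
      moreover have "((\<lambda>s. L2_inner x s * L2_inner (\<psi> s) (u i)) has_sum L2_inner y (u i)) T"
        by (rule L2_sum_on_inner[OF y(2) \<psi>L y(1) uL])
      ultimately have "L2_inner x (v' i) = L2_inner y (u i)"
        by (rule has_sum_cong_unique) (simp only: sv')
      then show ?thesis using 0 by simp
    qed
    then have y0: "L2_norm y = 0" using totu y(1) by (simp add: total_in_def)
    have "L2_inner x s = 0" if "s \<in> T" for s
      using L2_sum_on_coefficient[OF on\<psi> y(2,1) that] L2_norm_zero_inner[OF y(1) \<psi>L[OF that] y0] by simp
    then show "L2_norm x = 0" using totT x by (simp add: total_in_def)
  qed
  \<comment> \<open>\<open>w j\<close> has no component along \<open>S1\<close>, and along
    \<open>S0\<close> the coefficients of \<open>v' i\<close> and \<open>v i\<close> agree because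
    \<open>\<psi>\<close> is \<open>V\<close> there.\<close>
  have wv': "L2_inner (w j) (v' i) = L2_inner (f i) (u j)" for i j
  proof -
    have "((\<lambda>s. L2_inner (w j) s * L2_inner s (v' i)) has_sum L2_inner (w j) (v' i)) T"
      by (rule L2_sum_on_inner[OF expT[OF wL] TL wL v'L])
    moreover have "((\<lambda>s. L2_inner (w j) s * L2_inner s (v i)) has_sum L2_inner (w j) (v i)) T"
      by (rule L2_sum_on_inner[OF expT[OF wL] TL wL vL])
    moreover have "L2_inner (w j) s * L2_inner s (v' i) = L2_inner (w j) s * L2_inner s (v i)" if "s \<in> T" for s
    proof (cases "s \<in> S0")
      case True
      then show ?thesis using sv'[OF that, of i] \<psi>0 Vu[OF S0L, of s i] by simp
    next
      case False
      then have "s \<in> S1" using that by (simp add: T_def)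
      then have "L2_inner s (w j) = 0" using S1(1) by (auto simp: orthogonal_complement_def)
      then show ?thesis using L2_inner_cnj[of s "w j"] by simp
    qed
    ultimately have "L2_inner (w j) (v' i) = L2_inner (w j) (v i)"
      by (rule has_sum_cong_unique)
    then show ?thesis using weak_R_dual_inner[OF weak] by simp
  qed
  have "L2_has_sum (\<lambda>i t. L2_inner (f i) (u j) * v' i t) (w j)" for j
    using orthonormal_total_expansion[OF closed_subspace_UNIV onv' v'L totv' wL[of j]]
    unfolding wv' L2_sum_on_def L2_has_sum_def lincomb_def .
  moreover have "orthonormal_basis u" "orthonormal_basis v'"
    by (rule orthonormal_basisI[OF onu totu], rule orthonormal_basisI[OF onv' totv'])
  ultimately have "is_R_dual w f u v'"
    using weak by (simp add: is_R_dual_def is_weak_R_dual_def)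
  then show ?thesis by (rule exI[of _ v'])
qed

theorem corollary4p2:
  fixes a b :: real and f :: "real \<Rightarrow> complex"
  assumes "a > 0" and "b > 0" and "f \<in> L2"
    and "frame (gabor_system a b f)"
    and "\<exists>u v. is_weak_R_dual (adjoint_system a b f) (gabor_system a b f) u v"
  shows "\<exists>u v. is_R_dual (adjoint_system a b f) (gabor_system a b f) u v"
proof -
  note a = assms(1) and b = assms(2) and f = assms(3)
  define w where "w = adjoint_system a b f"
  define g where "g = gabor_system a b f"
  obtain A B where A: "0 < A" "A \<le> B" and AB: "frame_with_bounds A B g"
    using assms(4) unfolding frame_def g_def by blast
  have B: "0 < B" using A by simp
  obtain u v where weak: "is_weak_R_dual w g u v"
    using assms(5) unfolding w_def g_def by blast
  have u: "parseval_frame u" and v: "parseval_frame v"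
    using weak by (simp_all add: is_weak_R_dual_def)
  have wL: "w i \<in> L2" for i unfolding w_def by (rule L2_adjoint_system[OF f a b])
  have gL: "g i \<in> L2" for i unfolding g_def by (rule L2_gabor_system[OF f])
  have cross: "L2_inner (w j) (v i) = L2_inner (g i) (u j)" for i j
    by (rule weak_R_dual_inner[OF weak])
  have beg: "bessel B UNIV g" using frame_with_bounds_bessel[OF AB] B by simp
  have bew: "bessel B UNIV w" by (rule cross_gram_bessel[OF v u wL beg cross])
  have riesz_w: "A * (\<Sum>j\<in>F. (cmod (c j))\<^sup>2) \<le> (L2_norm (lincomb F c w))\<^sup>2" if F: "finite F" for F c
    unfolding w_def
  proof (rule gabor_duality[OF a b f])
    fix h assume h: "h \<in> L2"
    show "(\<lambda>i. (cmod (L2_inner h (gabor_system a b f i)))\<^sup>2) summable_on UNIV"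
      "A * (L2_norm h)\<^sup>2 \<le> (\<Sum>\<^sub>\<infinity>i. (cmod (L2_inner h (gabor_system a b f i)))\<^sup>2)"
      using AB h unfolding frame_with_bounds_def g_def by blast+
  qed (use A F in auto)
  \<comment> \<open>Both cases below keep this \<open>u\<close>; only the second basis depends on
    whether \<open>w\<close> is total.\<close>
  note onu = cross_gram_orthonormal[OF v u wL beg cross B A(1) riesz_w]
  have csw: "closed_subspace (orthogonal_complement (range w))"
    by (rule closed_subspace_orthogonal_complement) (use wL in blast)
  obtain S1 where S1: "S1 \<subseteq> orthogonal_complement (range w)" "orthonormal_on S1 (\<lambda>s. s)"
      "total_in (orthogonal_complement (range w)) S1 (\<lambda>s. s)"
    by (rule closed_subspace_orthonormal_total[OF csw])
  have "\<exists>u v. is_R_dual w g u v"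
  proof (cases "S1 = {}")
    case False
    have "infinite S1"
    proof (rule translation_invariant_infinite[OF csw _ _ S1 False])
      show "0 < 1 / b" using b by simp
      fix x n assume "x \<in> orthogonal_complement (range w)"
      then show "(\<lambda>t. x (t + real n * (1 / b))) \<in> orthogonal_complement (range w)"
        unfolding w_def by (rule adjoint_complement_translation[OF a b f])
    qed
    from weak_R_dual_extend[OF weak onu S1 this] show ?thesis by (rule exI[of _ u])
  next
    case True
    \<comment> \<open>An empty total family means that the complement contains only null
      functions.\<close>
    have totw: "total_in L2 UNIV w"
      using S1(3) True by (auto simp: total_in_def orthogonal_complement_def)
    have ab: "0 < 1 / b" "0 < 1 / a" "0 < a * b" using a b by auto
    have gw: "gabor_system (1 / b) (1 / a) f i = (\<lambda>t. of_real (sqrt (a * b)) * w i t)" for i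
      using a b by (simp add: w_def adjoint_system_gabor fun_eq_iff real_sqrt_mult)
    have cgw: "(cmod (L2_inner h (gabor_system (1 / b) (1 / a) f i)))\<^sup>2
        = a * b * (cmod (L2_inner h (w i)))\<^sup>2" for h i
    proof -
      have "cmod (L2_inner h (gabor_system (1 / b) (1 / a) f i)) = sqrt (a * b) * cmod (L2_inner h (w i))"
        unfolding gw L2_inner_norm_commute[of h] L2_inner_scale_left norm_mult using ab by simp
      then show ?thesis using ab(3) by (simp add: power_mult_distrib)
    qed
    have riesz_g: "A * (\<Sum>i\<in>F. (cmod (c i))\<^sup>2) \<le> (L2_norm (lincomb F c g))\<^sup>2" if F: "finite F" for F c
    proof -
      \<comment> \<open>On the lattice \<open>(1/b, 1/a)\<close> the Gabor system is
        \<open>sqrt (a * b)\<close> times \<open>w\<close>, which multiplies the frame bound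
        \<open>A\<close> by \<open>a * b\<close>. The adjoint system there is
        \<open>sqrt (a * b)\<close> times \<open>g\<close>, so the factor cancels again.\<close>
      have "a * b * A * (\<Sum>i\<in>F. (cmod (c i))\<^sup>2) \<le> (L2_norm (lincomb F c (adjoint_system (1 / b) (1 / a) f)))\<^sup>2"
      proof (rule gabor_duality[OF ab(1,2) f])
        fix h assume h: "h \<in> L2"
        show "(\<lambda>i. (cmod (L2_inner h (gabor_system (1 / b) (1 / a) f i)))\<^sup>2) summable_on UNIV"
          unfolding cgw by (rule summable_on_cmult_right[OF bessel_summable[OF bew h]])
        have "A * (L2_norm h)\<^sup>2 \<le> (\<Sum>\<^sub>\<infinity>i. (cmod (L2_inner h (w i)))\<^sup>2)"
          by (rule lower_riesz_total_frame_bound[OF bew A(1) riesz_w totw h])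
        then show "a * b * A * (L2_norm h)\<^sup>2 \<le> (\<Sum>\<^sub>\<infinity>i. (cmod (L2_inner h (gabor_system (1 / b) (1 / a) f i)))\<^sup>2)"
          unfolding cgw infsum_cmult_right' using mult_left_mono[OF _ less_imp_le[OF ab(3)]]
          by (simp only: mult.assoc)
      qed (use A ab F in auto)
      also have "lincomb F c (adjoint_system (1 / b) (1 / a) f)
          = (\<lambda>t. of_real (sqrt (a * b)) * lincomb F c g t)"
        by (simp add: lincomb_def fun_eq_iff adjoint_system_swap[OF a b] g_def sum_distrib_left mult_ac)
      also have "(L2_norm (\<lambda>t. of_real (sqrt (a * b)) * lincomb F c g t))\<^sup>2
          = a * b * (L2_norm (lincomb F c g))\<^sup>2"
        unfolding L2_norm_scale power_mult_distrib using ab(3) by simp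
      finally have "a * b * (A * (\<Sum>i\<in>F. (cmod (c i))\<^sup>2)) \<le> a * b * (L2_norm (lincomb F c g))\<^sup>2"
        by (simp only: mult.assoc)
      then show ?thesis using ab(3) by (rule mult_left_le_imp_le)
    qed
    have cross': "L2_inner (g i) (u j) = L2_inner (w j) (v i)" for i j
      by (rule cross[symmetric])
    \<comment> \<open>The exchanged roles: \<open>g\<close> has the lower Riesz bound,
      \<open>w\<close> the Bessel bound, and \<open>v\<close> becomes the orthonormal
      family.\<close>
    note onv = cross_gram_orthonormal[OF u v gL bew cross' B A(1) riesz_g]
    have "is_R_dual w g u v"
      using weak orthonormal_basisI[OF onu] orthonormal_basisI[OF onv]
      by (simp add: is_R_dual_def is_weak_R_dual_def)
    then show ?thesis by blast
  qed
  then show ?thesis by (simp only: w_def g_def)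
qed

end
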